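(* Let $n,m,p$ be non-negative integers with $n>0$, and let $\Sigma\in\tilde\Sigma_{n,m,p}$ be a linear dynamical system. (1) $\Sigma$ is $(-1)$-stable if and only if $\Phi_L(\Sigma)\in\tilde L_{n,m,p}$ is $1$-lowerstable. (2) $\Sigma$ is $1$-stable if and only if $\Phi_L(\Sigma)\in\tilde L_{n,m,p}$ is $1$-upperstable.
   Context: $k$ is an algebraically closed field of characteristic $0$. A linear dynamical system is $\Sigma=(A,B,C,D)$ with $A\in k^{n\times n},B\in k^{n\times m},C\in k^{p\times n},D\in k^{p\times m}$; $\tilde\Sigma_{n,m,p}$ is the vector space of these. $G=\mathrm{GL}_n$ acts by $g\cdot(A,B,C,D)=(gAg^{-1},gB,Cg^{-1},D)$. For $\chi\in\mathbb{Z}$, $\Sigma$ is $\chi$-stable if there are $N\ge1$ and a regular function $f$ on $\tilde\Sigma_{n,m,p}$ with $f(gx)=\det(g)^{N\chi}f(x)$ for all $g,x$, $f(\Sigma)\neq0$, all $G$-orbits in $\{f\neq0\}$ closed in $\{f\neq 0\}$, and $\dim G\cdot\Sigma=\dim G/\Delta$, where $\Delta$ is the kernel of the action. A Lomadze system of type $(n,m,p)$ is a triple $(K,L,M)$ with $K,L\in k^{(n+p)\times n}$, $M\in k^{(n+p)\times(p+m)}$; $\tilde L_{n,m,p}$ is the space of these. The map $\Phi_L:\tilde\Sigma_{n,m,p}\to\tilde L_{n,m,p}$ sends $(A,B,C,D)$ to $$K=\begin{pmatrix}\mathrm{id}_n\\0\end{pmatrix},\quad L=\begin{pmatrix}A\\C\end{pmatrix},\quad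 M=\begin{pmatrix}0&B\\ \mathrm{id}_p&D\end{pmatrix}.$$ For $\lambda\in[0,\infty]$, $S=(K,L,M)$ is $\lambda$-lowerstable (respectively $\lambda$-upperstable) if for all subspaces $U\subset k^n$, $V\subset k^{n+p}$: (1) if ($\dim U>0$ or $\dim V>0$) and $K(U)+L(U)\subset V$, then $\lambda<\frac{\dim V}{\dim U}$ (respectively $\lambda\le\frac{\dim V}{\dim U}$); (2) if ($U\subsetneq k^n$ or $V\subsetneq k^{n+p}$), $K(U)+L(U)\subset V$ and $\mathrm{im}\,M\subset V$, then $\lambda\ge\frac{n+p-\dim V}{n-\dim U}$ (respectively $\lambda>\frac{n+p-\dim V}{n-\dim U}$). Fractions $a/0$ with $a>0$ are $\infty$. *)

theory Defs
  imports
    "Jordan_Normal_Form.VS_Connect"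
    "HOL-Algebra.Group_Action"
    "HOL-Analysis.Abstract_Topology"
    "HOL-Library.Extended_Nat"
    "HOL-Library.Extended_Nonnegative_Real"
begin

text \<open>
  Polynomial functions on an affine space with a given set \<open>X\<close> of coordinate functions: the
  subalgebra of all functions generated by \<open>X\<close>.
\<close>

inductive_set poly_fun :: "('a \<Rightarrow> 'k) set \<Rightarrow> ('a \<Rightarrow> 'k :: comm_ring_1) set"
  for X :: "('a \<Rightarrow> 'k) set" where
  poly_fun_coord: "h \<in> X \<Longrightarrow> h \<in> poly_fun X"
| poly_fun_const: "(\<lambda>_. c) \<in> poly_fun X"
| poly_fun_add: "f \<in> poly_fun X \<Longrightarrow> g \<in> poly_fun X \<Longrightarrow> (\<lambda>x. f x + g x) \<in> poly_fun X"
| poly_fun_mult: "f \<in> poly_fun X \<Longrightarrow> g \<in> poly_fun X \<Longrightarrow> (\<lambda>x. f x * g x) \<in> poly_fun X"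

text \<open>The closed sets are the common zero loci in \<open>E\<close> of families of polynomial functions.\<close>

definition zariski :: "'a set \<Rightarrow> ('a \<Rightarrow> 'k :: field) set \<Rightarrow> 'a topology" where
  "zariski E X = topology (\<lambda>U. \<exists>F \<subseteq> poly_fun X. U = {x \<in> E. \<exists>f\<in>F. f x \<noteq> 0})"

lemma istopology_zariski:
  fixes X :: "('a \<Rightarrow> 'k :: field) set"
  shows "istopology (\<lambda>U. \<exists>F \<subseteq> poly_fun X. U = {x \<in> E. \<exists>f\<in>F. f x \<noteq> 0})"
  unfolding istopology_def
proof (intro conjI allI impI)
  fix S T
  assume "\<exists>F \<subseteq> poly_fun X. S = {x \<in> E. \<exists>f\<in>F. f x \<noteq> 0}"
    and "\<exists>F \<subseteq> poly_fun X. T = {x \<in> E. \<exists>f\<in>F. f x \<noteq> 0}"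
  then obtain F G where F: "F \<subseteq> poly_fun X" "S = {x \<in> E. \<exists>f\<in>F. f x \<noteq> 0}"
    and G: "G \<subseteq> poly_fun X" "T = {x \<in> E. \<exists>f\<in>G. f x \<noteq> 0}" by blast
  define H where "H = (\<lambda>(f, g) x. f x * g x) ` (F \<times> G)"
  have "H \<subseteq> poly_fun X" using F(1) G(1) by (auto simp: H_def intro!: poly_fun_mult)
  moreover have "S \<inter> T = {x \<in> E. \<exists>h\<in>H. h x \<noteq> 0}"
    by (auto simp: F(2) G(2) H_def)
  ultimately show "\<exists>F \<subseteq> poly_fun X. S \<inter> T = {x \<in> E. \<exists>f\<in>F. f x \<noteq> 0}"
    by (intro exI[of _ H] conjI)
next
  fix \<K>
  assume "\<forall>K\<in>\<K>. \<exists>F \<subseteq> poly_fun X. K = {x \<in> E. \<exists>f\<in>F. f x \<noteq> 0}"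
  then have "\<exists>F. \<forall>K\<in>\<K>. F K \<subseteq> poly_fun X \<and> K = {x \<in> E. \<exists>f\<in>F K. f x \<noteq> 0}"
    by (rule bchoice)
  then obtain F where *: "\<forall>K\<in>\<K>. F K \<subseteq> poly_fun X \<and> K = {x \<in> E. \<exists>f\<in>F K. f x \<noteq> 0}"
    by (rule exE)
  have F: "F K \<subseteq> poly_fun X" "K = {x \<in> E. \<exists>f\<in>F K. f x \<noteq> 0}" if "K \<in> \<K>" for K
    using bspec[OF * that] by (rule conjunct1, rule conjunct2)
  have "(\<lambda>K. {x \<in> E. \<exists>f\<in>F K. f x \<noteq> 0}) ` \<K> = (\<lambda>K. K) ` \<K>"
    by (rule image_cong[OF refl]) (rule F(2)[symmetric])
  then have "\<Union>\<K> = (\<Union>K\<in>\<K>. {x \<in> E. \<exists>f\<in>F K. f x \<noteq> 0})" by simp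
  also have "\<dots> = {x \<in> E. \<exists>f\<in>(\<Union>K\<in>\<K>. F K). f x \<noteq> 0}" by blast
  finally show "\<exists>F \<subseteq> poly_fun X. \<Union>\<K> = {x \<in> E. \<exists>f\<in>F. f x \<noteq> 0}"
    using F(1) by (intro exI[of _ "\<Union>K\<in>\<K>. F K"] conjI UN_least)
qed

lemma openin_zariski:
  "openin (zariski E X) U \<longleftrightarrow> (\<exists>F \<subseteq> poly_fun X. U = {x \<in> E. \<exists>f\<in>F. f x \<noteq> 0})"
  unfolding zariski_def topology_inverse'[OF istopology_zariski] ..

lemma topspace_zariski: "topspace (zariski E X) = E"
proof (rule subset_antisym)
  have "openin (zariski E X) E"
    unfolding openin_zariski
    by (rule exI[of _ "{\<lambda>_. 1}"]) (auto intro: poly_fun_const)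
  then show "E \<subseteq> topspace (zariski E X)" by (rule openin_subset)
  have "openin (zariski E X) (topspace (zariski E X))" by (rule openin_topspace)
  then show "topspace (zariski E X) \<subseteq> E" unfolding openin_zariski by auto
qed

definition quotient_topology :: "'a topology \<Rightarrow> ('a \<Rightarrow> 'b) \<Rightarrow> 'b topology" where
  "quotient_topology X q =
     topology (\<lambda>U. U \<subseteq> q ` topspace X \<and> openin X {x \<in> topspace X. q x \<in> U})"

lemma istopology_quotient_topology:
  "istopology (\<lambda>U. U \<subseteq> q ` topspace X \<and> openin X {x \<in> topspace X. q x \<in> U})"
  unfolding istopology_def
proof (intro conjI allI impI)
  fix S T
  assume "S \<subseteq> q ` topspace X \<and> openin X {x \<in> topspace X. q x \<in> S}"
    and "T \<subseteq> q ` topspace X \<and> openin X {x \<in> topspace X. q x \<in> T}"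
  moreover have "{x \<in> topspace X. q x \<in> S \<inter> T}
      = {x \<in> topspace X. q x \<in> S} \<inter> {x \<in> topspace X. q x \<in> T}" by blast
  ultimately show "S \<inter> T \<subseteq> q ` topspace X" "openin X {x \<in> topspace X. q x \<in> S \<inter> T}"
    by auto
next
  fix \<K>
  assume *: "\<forall>K\<in>\<K>. K \<subseteq> q ` topspace X \<and> openin X {x \<in> topspace X. q x \<in> K}"
  then show "\<Union>\<K> \<subseteq> q ` topspace X" by blast
  have "{x \<in> topspace X. q x \<in> \<Union>\<K>} = (\<Union>K\<in>\<K>. {x \<in> topspace X. q x \<in> K})" by blast
  then show "openin X {x \<in> topspace X. q x \<in> \<Union>\<K>}" using * by auto
qed

lemma openin_quotient_topology:
  "openin (quotient_topology X q) U \<longleftrightarrow>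
     U \<subseteq> q ` topspace X \<and> openin X {x \<in> topspace X. q x \<in> U}"
  unfolding quotient_topology_def topology_inverse'[OF istopology_quotient_topology] ..

lemma topspace_quotient_topology: "topspace (quotient_topology X q) = q ` topspace X"
proof (rule subset_antisym)
  have "{x \<in> topspace X. q x \<in> q ` topspace X} = topspace X" by blast
  then have "openin (quotient_topology X q) (q ` topspace X)"
    by (simp add: openin_quotient_topology)
  then show "q ` topspace X \<subseteq> topspace (quotient_topology X q)" by (rule openin_subset)
  have "openin (quotient_topology X q) (topspace (quotient_topology X q))" by (rule openin_topspace)
  then show "topspace (quotient_topology X q) \<subseteq> q ` topspace X"
    unfolding openin_quotient_topology by (rule conjunct1)
qed

lemma quotient_map_quotient_topology: "quotient_map X (quotient_topology X q) q"
  unfolding quotient_map_def topspace_quotient_topology openin_quotient_topology by blast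

definition irreducible_closedin :: "'a topology \<Rightarrow> 'a set \<Rightarrow> bool" where
  "irreducible_closedin X Z \<longleftrightarrow> closedin X Z \<and> Z \<noteq> {} \<and>
     (\<forall>S T. closedin X S \<longrightarrow> closedin X T \<longrightarrow> Z \<subseteq> S \<union> T \<longrightarrow> Z \<subseteq> S \<or> Z \<subseteq> T)"

text \<open>
  Krull dimension: the supremum of the lengths \<open>r\<close> of chains
  \<open>Z\<^sub>0 \<subset> \<dots> \<subset> Z\<^sub>r\<close> of irreducible closed subsets.  For varieties it is the usual
  dimension.  (The value for the empty space is \<open>0\<close>.)
\<close>

definition krull_dim :: "'a topology \<Rightarrow> enat" where
  "krull_dim X = Sup {enat r | r. \<exists>Z :: nat \<Rightarrow> 'a set.
     (\<forall>i\<le>r. irreducible_closedin X (Z i)) \<and> (\<forall>i<r. Z i \<subset> Z (Suc i))}"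


subsection \<open>Linear dynamical systems\<close>

type_synonym 'k lds = "'k mat \<times> 'k mat \<times> 'k mat \<times> 'k mat"

definition lds_space :: "nat \<Rightarrow> nat \<Rightarrow> nat \<Rightarrow> 'k lds set" where
  "lds_space n m p =
     carrier_mat n n \<times> carrier_mat n m \<times> carrier_mat p n \<times> carrier_mat p m"

definition lds_coords :: "nat \<Rightarrow> nat \<Rightarrow> nat \<Rightarrow> ('k lds \<Rightarrow> 'k) set" where
  "lds_coords n m p =
     {\<lambda>(A, B, C, D). A $$ (i, j) | i j. i < n \<and> j < n} \<union>
     {\<lambda>(A, B, C, D). B $$ (i, j) | i j. i < n \<and> j < m} \<union>
     {\<lambda>(A, B, C, D). C $$ (i, j) | i j. i < p \<and> j < n} \<union>
     {\<lambda>(A, B, C, D). D $$ (i, j) | i j. i < p \<and> j < m}"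

definition lds_zariski :: "nat \<Rightarrow> nat \<Rightarrow> nat \<Rightarrow> 'k :: field lds topology" where
  "lds_zariski n m p = zariski (lds_space n m p) (lds_coords n m p)"

definition GL :: "nat \<Rightarrow> 'k :: field mat monoid" where
  "GL n = units_of (ring_mat TYPE('k) n ())"

lemma group_GL: "group (GL n :: 'k :: field mat monoid)"
proof -
  interpret ring "ring_mat TYPE('k) n ()" by (rule ring_mat)
  show ?thesis unfolding GL_def by (rule units_group)
qed

text \<open>
  The topology of the affine variety \<open>GL\<^sub>n\<close> is the one induced from the space of matrices,
  in which it is a principal open subset.
\<close>

definition GL_zariski :: "nat \<Rightarrow> 'k :: field mat topology" where
  "GL_zariski n = subtopology
     (zariski (carrier_mat n n) {\<lambda>g. g $$ (i, j) | i j. i < n \<and> j < n}) (carrier (GL n))"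

definition lds_act :: "nat \<Rightarrow> nat \<Rightarrow> nat \<Rightarrow> 'k :: field mat \<Rightarrow> 'k lds \<Rightarrow> 'k lds" where
  "lds_act n m p g = (\<lambda>(A, B, C, D) \<in> lds_space n m p.
     (g * A * inv\<^bsub>GL n\<^esub> g, g * B, C * inv\<^bsub>GL n\<^esub> g, D))"

lemma GL_simps:
  "mult (GL n) = (*)" "one (GL n) = 1\<^sub>m n"
  by (simp_all add: GL_def units_of_def ring_mat_simps)

lemma GL_carrier: "carrier (GL n :: 'k::field mat monoid) = {g \<in> carrier_mat n n. invertible_mat g}"
  unfolding GL_def units_of_carrier Units_def
  by (auto simp: ring_mat_simps invertible_mat_def inverts_mat_def)
   (metis carrier_matD carrier_matI index_mult_mat(2,3) index_one_mat(2,3))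

lemma GL_inverse: assumes "g \<in> carrier (GL n :: 'k::field mat monoid)"
  shows "g \<in> carrier_mat n n" "inv\<^bsub>GL n\<^esub> g \<in> carrier_mat n n" "inv\<^bsub>GL n\<^esub> g \<in> carrier (GL n)"
    "inv\<^bsub>GL n\<^esub> g * g = 1\<^sub>m n" "g * inv\<^bsub>GL n\<^esub> g = 1\<^sub>m n"
proof -
  interpret group "GL n :: 'k mat monoid" by (rule group_GL)
  show 1: "inv\<^bsub>GL n\<^esub> g \<in> carrier (GL n)" using assms by auto
  show "g \<in> carrier_mat n n" "inv\<^bsub>GL n\<^esub> g \<in> carrier_mat n n"
    using assms 1 unfolding GL_carrier by auto
  show  "inv\<^bsub>GL n\<^esub> g * g = 1\<^sub>m n" "g * inv\<^bsub>GL n\<^esub> g = 1\<^sub>m n"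
    using l_inv[OF assms] r_inv[OF assms] by (simp_all add: GL_simps)
qed

lemma lds_act_closed: "g \<in> carrier (GL n) \<Longrightarrow> x \<in> lds_space n m p \<Longrightarrow> lds_act n m p g x \<in> lds_space n m p"
  using GL_inverse(1,2)[of g n] unfolding lds_act_def by (auto simp: lds_space_def)

lemma lds_act_mult: assumes "g \<in> carrier (GL n)" "h \<in> carrier (GL n)" "x \<in> lds_space n m p"
  shows "lds_act n m p (g * h) x = lds_act n m p g (lds_act n m p h x :: 'k::field lds)"
proof -
  interpret group "GL n :: 'k mat monoid" by (rule group_GL)
  obtain A B C D where x: "x = (A,B,C,D)" by (cases x)
  note c = GL_inverse(1,2)[OF assms(1)] GL_inverse(1,2)[OF assms(2)]
  have d: "A \<in> carrier_mat n n" "B \<in> carrier_mat n m" "C \<in> carrier_mat p n" 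
    using assms(3) unfolding x lds_space_def by auto
  have i: "inv\<^bsub>GL n\<^esub> (g*h) = inv\<^bsub>GL n\<^esub> h * inv\<^bsub>GL n\<^esub> g"
    using inv_mult_group[OF assms(1,2)] by (simp add: GL_simps)
  have e: "g * h * A * (inv\<^bsub>GL n\<^esub> h * inv\<^bsub>GL n\<^esub> g) = g * (h * A * inv\<^bsub>GL n\<^esub> h) * inv\<^bsub>GL n\<^esub> g"
    using c d by (simp add: assoc_mult_mat[of _ n n _ n _ n])
  have e2: "g * h * B = g * (h * B)" using c d by (simp add: assoc_mult_mat[of _ n n _ n _ m])
  have e3: "C * (inv\<^bsub>GL n\<^esub> h * inv\<^bsub>GL n\<^esub> g) = C * inv\<^bsub>GL n\<^esub> h * inv\<^bsub>GL n\<^esub> g" using c d by (simp add: assoc_mult_mat[of _ p n _ n _ n])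
  have "lds_act n m p h x \<in> lds_space n m p" using lds_act_closed assms by blast
  then show ?thesis using assms(3) unfolding lds_act_def x by (simp add: i e e2 e3)
qed

lemma lds_act_one: assumes "x \<in> lds_space n m p"
  shows "lds_act n m p (1\<^sub>m n) x = (x :: 'k::field lds)"
proof -
  interpret group "GL n :: 'k mat monoid" by (rule group_GL)
  have "inv\<^bsub>GL n\<^esub> (1\<^sub>m n :: 'k mat) = 1\<^sub>m n" using inv_one by (simp add: GL_simps)
  then show ?thesis using assms unfolding lds_act_def by (auto simp: lds_space_def)
qed

lemma group_action_lds_act:
  "group_action (GL n) (lds_space n m p :: 'k::field lds set) (lds_act n m p)"
proof -
  interpret group "GL n :: 'k mat monoid" by (rule group_GL)
  let ?E = "lds_space n m p :: 'k lds set"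
  have bij: "lds_act n m p g \<in> Bij ?E" if g: "g \<in> carrier (GL n)" for g
  proof -
    let ?h = "inv\<^bsub>GL n\<^esub> g"
    have "bij_betw (lds_act n m p g) ?E ?E"
      by (rule bij_betw_byWitness[of _ "lds_act n m p ?h"])
        (use g GL_inverse[OF g] in \<open>auto simp: lds_act_closed lds_act_mult[symmetric] lds_act_one\<close>)
    then show ?thesis unfolding Bij_def lds_act_def by auto
  qed
  show ?thesis unfolding group_action_def group_hom_def group_hom_axioms_def
  proof (intro conjI group_GL group_BijGroup homI)
    fix g assume "g \<in> carrier (GL n :: 'k mat monoid)" then show "lds_act n m p g \<in> carrier (BijGroup ?E)"
      using bij by (simp add: BijGroup_def)
  next
    fix g h assume gh: "g \<in> carrier (GL n :: 'k mat monoid)" "h \<in> carrier (GL n :: 'k mat monoid)"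
    have "lds_act n m p (g * h) = compose ?E (lds_act n m p g) (lds_act n m p h)"
      using gh by (auto intro!: extensionalityI[of _ ?E] simp: compose_def lds_act_mult) (simp add: lds_act_def)
    then show "lds_act n m p (g \<otimes>\<^bsub>GL n\<^esub> h) = lds_act n m p g \<otimes>\<^bsub>BijGroup ?E\<^esub> lds_act n m p h"
      using gh bij by (simp add: BijGroup_def GL_simps)
  qed
qed

definition act_kernel :: "nat \<Rightarrow> nat \<Rightarrow> nat \<Rightarrow> 'k :: field mat set" where
  "act_kernel n m p = kernel (GL n) (BijGroup (lds_space n m p)) (lds_act n m p)"

text \<open>
  The space underlying the algebraic quotient group of \<open>GL\<^sub>n\<close> by the kernel of the action: the
  set of cosets with the quotient of the Zariski topology.
\<close>

definition GL_mod_kernel :: "nat \<Rightarrow> nat \<Rightarrow> nat \<Rightarrow> 'k :: field mat set topology" where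
  "GL_mod_kernel n m p =
     quotient_topology (GL_zariski n) (\<lambda>g. act_kernel n m p #>\<^bsub>GL n\<^esub> g)"

definition chi_stable ::
    "nat \<Rightarrow> nat \<Rightarrow> nat \<Rightarrow> int \<Rightarrow> 'k :: field lds \<Rightarrow> bool" where
  "chi_stable n m p \<chi> \<Sigma> \<longleftrightarrow>
     (\<exists>N\<ge>1. \<exists>f \<in> poly_fun (lds_coords n m p).
        (\<forall>g \<in> carrier (GL n). \<forall>x \<in> lds_space n m p.
           f (lds_act n m p g x) = det g powi (int N * \<chi>) * f x) \<and>
        f \<Sigma> \<noteq> 0 \<and>
        (\<forall>x \<in> lds_space n m p. f x \<noteq> 0 \<longrightarrow>
           closedin (subtopology (lds_zariski n m p) {y \<in> lds_space n m p. f y \<noteq> 0})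
             (orbit (GL n) (lds_act n m p) x)) \<and>
        krull_dim (subtopology (lds_zariski n m p) (orbit (GL n) (lds_act n m p) \<Sigma>)) =
          krull_dim (GL_mod_kernel n m p :: 'k mat set topology))"


subsection \<open>Lomadze systems\<close>

type_synonym 'k lomadze = "'k mat \<times> 'k mat \<times> 'k mat"

definition lomadze_space :: "nat \<Rightarrow> nat \<Rightarrow> nat \<Rightarrow> 'k lomadze set" where
  "lomadze_space n m p =
     carrier_mat (n + p) n \<times> carrier_mat (n + p) n \<times> carrier_mat (n + p) (p + m)"

definition Phi_L :: "nat \<Rightarrow> nat \<Rightarrow> nat \<Rightarrow> 'k :: field lds \<Rightarrow> 'k lomadze" where
  "Phi_L n m p = (\<lambda>(A, B, C, D).
     (1\<^sub>m n @\<^sub>r 0\<^sub>m p n, A @\<^sub>r C, four_block_mat (0\<^sub>m n p) B (1\<^sub>m p) D))"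

lemma Phi_L_in_lomadze_space:
  "\<Sigma> \<in> lds_space n m p \<Longrightarrow> Phi_L n m p \<Sigma> \<in> lomadze_space n m p"
  unfolding lds_space_def lomadze_space_def Phi_L_def by auto

definition is_subspace :: "nat \<Rightarrow> 'k :: field vec set \<Rightarrow> bool" where
  "is_subspace d U \<longleftrightarrow> VectorSpace.subspace class_ring U (module_vec TYPE('k) d)"

definition sdim :: "nat \<Rightarrow> 'k :: field vec set \<Rightarrow> nat" where
  "sdim d U = vectorspace.dim class_ring (module_vec TYPE('k) d\<lparr>carrier := U\<rparr>)"

definition sum_image :: "'k :: field mat \<Rightarrow> 'k mat \<Rightarrow> 'k vec set \<Rightarrow> 'k vec set" where
  "sum_image K L U = {K *\<^sub>v u + L *\<^sub>v u' | u u'. u \<in> U \<and> u' \<in> U}"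

definition mat_im :: "'k :: field mat \<Rightarrow> 'k vec set" where
  "mat_im M = (\<lambda>v. M *\<^sub>v v) ` carrier_vec (dim_col M)"

text \<open>
  Slopes are taken in \<^typ>\<open>ennreal\<close>, where \<open>a / 0 = \<infinity>\<close> for \<open>a > 0\<close>; the side conditions on
  \<open>U\<close> and \<open>V\<close> exclude \<open>0 / 0\<close>.
\<close>

definition lowerstable ::
    "nat \<Rightarrow> nat \<Rightarrow> nat \<Rightarrow> ennreal \<Rightarrow> 'k :: field lomadze \<Rightarrow> bool" where
  "lowerstable n m p l = (\<lambda>(K, L, M).
     \<forall>U V. is_subspace n U \<longrightarrow> is_subspace (n + p) V \<longrightarrow>
       ((sdim n U > 0 \<or> sdim (n + p) V > 0) \<and> sum_image K L U \<subseteq> V \<longrightarrow>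
          l < of_nat (sdim (n + p) V) / of_nat (sdim n U)) \<and>
       ((U \<subset> carrier_vec n \<or> V \<subset> carrier_vec (n + p)) \<and>
          sum_image K L U \<subseteq> V \<and> mat_im M \<subseteq> V \<longrightarrow>
          l \<ge> of_nat (n + p - sdim (n + p) V) / of_nat (n - sdim n U)))"

definition upperstable ::
    "nat \<Rightarrow> nat \<Rightarrow> nat \<Rightarrow> ennreal \<Rightarrow> 'k :: field lomadze \<Rightarrow> bool" where
  "upperstable n m p l = (\<lambda>(K, L, M).
     \<forall>U V. is_subspace n U \<longrightarrow> is_subspace (n + p) V \<longrightarrow>
       ((sdim n U > 0 \<or> sdim (n + p) V > 0) \<and> sum_image K L U \<subseteq> V \<longrightarrow>
          l \<le> of_nat (sdim (n + p) V) / of_nat (sdim n U)) \<and>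
       ((U \<subset> carrier_vec n \<or> V \<subset> carrier_vec (n + p)) \<and>
          sum_image K L U \<subseteq> V \<and> mat_im M \<subseteq> V \<longrightarrow>
          l > of_nat (n + p - sdim (n + p) V) / of_nat (n - sdim n U)))"

end

theory Submission
  imports Defs
begin

text \<open>
  Both equivalences pass through the two basic notions of linear control theory.  A system
  \<open>(A, B, C, D)\<close> is controllable if no proper \<open>A\<close>-invariant subspace contains the image of \<open>B\<close>,
  and observable if no nonzero \<open>A\<close>-invariant subspace lies in the kernel of \<open>C\<close>.  It is shown that
  \<open>1\<close>-stable and \<open>1\<close>-upperstable both mean controllable, and that \<open>(-1)\<close>-stable and
  \<open>1\<close>-lowerstable both mean observable.

  \<^emph>\<open>From an invariant to control theory.\<close>  Let \<open>f\<close> be a semi-invariant of weight \<open>N \<chi>\<close> and let \<open>U\<close>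
  be a subspace that violates controllability (\<open>\<chi> = 1\<close>) or observability (\<open>\<chi> = -1\<close>).  In a basis
  adapted to \<open>U\<close> the one-parameter group that scales \<open>U\<close> against a complement moves the system along
  a curve that extends to the parameter \<open>t = 0\<close>.  Semi-invariance makes the constant \<open>f (\<Sigma>)\<close> equal
  to a positive power of \<open>t\<close> times a polynomial in \<open>t\<close>, so \<open>f (\<Sigma>) = 0\<close>
  (\<open>semi_invariant_vanishes_in_limit\<close>).

  \<^emph>\<open>From control theory to an invariant.\<close>  If \<open>\<Sigma>\<close> is controllable, some \<open>n\<close> columns of the matrices
  \<open>A^i B\<close> form an invertible matrix \<open>R (\<Sigma>)\<close>, and \<open>f = det R\<close> satisfies \<open>f (g x) = det g * f x\<close>
  because \<open>R (g x) = g R (x)\<close>.  This equivariance does all the geometry at once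
  (\<open>chi_stable_if_slice\<close>).  On \<open>{f \<noteq> 0}\<close> the map \<open>x \<mapsto> R (x)^{-1} x\<close> is regular and its fibres are
  exactly the orbits, so orbits are closed there.  The map \<open>y \<mapsto> R (y) R (\<Sigma>)^{-1}\<close> is a
  regular inverse of \<open>g \<mapsto> g \<Sigma>\<close>, so the orbit is homeomorphic to \<open>GL_n\<close>, and since \<open>\<Sigma>\<close> has
  trivial stabiliser so is \<open>GL_n\<close> modulo the kernel of the action; hence the two Krull dimensions
  agree.  The observable case is the same with the inverse of \<open>n\<close> rows of the matrices \<open>C A^i\<close> in
  place of \<open>R\<close>.

  \<^emph>\<open>Slopes.\<close>  For a triple in the image of \<open>\<Phi>\<^sub>L\<close> the condition \<open>K (U) + L (U) \<subseteq> V\<close> forces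
  \<open>U \<times> 0 \<subseteq> V\<close>, and \<open>im M \<subseteq> V\<close> forces \<open>0 \<times> k^p \<subseteq> V\<close>.  All weak slope inequalities at \<open>\<lambda> = 1\<close> are
  therefore automatic, and a strict one fails only if \<open>V = U \<times> 0\<close> (where \<open>U\<close> is invariant and
  killed by \<open>C\<close>) or \<open>V = U \<times> k^p\<close> (where \<open>U\<close> is invariant and contains the image of \<open>B\<close>).
\<close>


section \<open>Regular functions on principal open sets\<close>

text \<open>
  The functions on \<open>E\<close> that become polynomial on \<open>{f \<noteq> 0}\<close> after multiplication by a power of \<open>f\<close>;
  only their values on \<open>{f \<noteq> 0}\<close> matter.  With \<open>f = 1\<close> these are the functions that agree on \<open>E\<close>
  with a polynomial, so one calculus serves both purposes.
\<close>

definition regular_fun :: "'a set \<Rightarrow> ('a \<Rightarrow> 'k) set \<Rightarrow> ('a \<Rightarrow> 'k) \<Rightarrow> ('a \<Rightarrow> 'k :: field) set" where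
  "regular_fun E X f = {h. \<exists>k. \<exists>q \<in> poly_fun X. \<forall>x\<in>E. f x \<noteq> 0 \<longrightarrow> h x * f x ^ k = q x}"

lemma regular_fun_cong:
  assumes "h \<in> regular_fun E X f" "\<And>x. x \<in> E \<Longrightarrow> f x \<noteq> 0 \<Longrightarrow> h' x = h x"
  shows "h' \<in> regular_fun E X f"
  using assms unfolding regular_fun_def by fastforce

lemma poly_fun_regular: "h \<in> poly_fun X \<Longrightarrow> h \<in> regular_fun E X f"
  unfolding regular_fun_def by (auto intro!: exI[of _ 0] bexI[of _ h])

lemma regular_fun_const: "(\<lambda>_. c) \<in> regular_fun E X f"
  by (rule poly_fun_regular) (rule poly_fun_const)

lemma regular_fun_coord: "h \<in> X \<Longrightarrow> h \<in> regular_fun E X f"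
  by (rule poly_fun_regular) (rule poly_fun_coord)

lemma poly_fun_power: "h \<in> poly_fun X \<Longrightarrow> (\<lambda>x. h x ^ k) \<in> poly_fun X"
  by (induction k) (auto intro: poly_fun_const poly_fun_mult)

lemma regular_fun_add:
  assumes f: "f \<in> poly_fun X" and "g \<in> regular_fun E X f" "h \<in> regular_fun E X f"
  shows "(\<lambda>x. g x + h x) \<in> regular_fun E X f"
proof -
  obtain k p l q where p: "p \<in> poly_fun X" "\<forall>x\<in>E. f x \<noteq> 0 \<longrightarrow> g x * f x ^ k = p x"
    and q: "q \<in> poly_fun X" "\<forall>x\<in>E. f x \<noteq> 0 \<longrightarrow> h x * f x ^ l = q x"
    using assms(2,3) unfolding regular_fun_def by auto
  have "(\<lambda>x. p x * f x ^ l + q x * f x ^ k) \<in> poly_fun X"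
    using p(1) q(1) f by (intro poly_fun_add poly_fun_mult poly_fun_power)
  moreover have "(g x + h x) * f x ^ (k + l) = p x * f x ^ l + q x * f x ^ k"
    if "x \<in> E" "f x \<noteq> 0" for x
  proof -
    have "(g x + h x) * f x ^ (k + l) = (g x * f x ^ k) * f x ^ l + (h x * f x ^ l) * f x ^ k"
      by (simp add: power_add algebra_simps)
    then show ?thesis using p(2) q(2) that by simp
  qed
  ultimately show ?thesis unfolding regular_fun_def mem_Collect_eq
    by (intro exI[of _ "k + l"] bexI[of _ "\<lambda>x. p x * f x ^ l + q x * f x ^ k"]) auto
qed

lemma regular_fun_mult:
  assumes "g \<in> regular_fun E X f" "h \<in> regular_fun E X f"
  shows "(\<lambda>x. g x * h x) \<in> regular_fun E X f"
proof -
  obtain k p l q where p: "p \<in> poly_fun X" "\<forall>x\<in>E. f x \<noteq> 0 \<longrightarrow> g x * f x ^ k = p x"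
    and q: "q \<in> poly_fun X" "\<forall>x\<in>E. f x \<noteq> 0 \<longrightarrow> h x * f x ^ l = q x"
    using assms unfolding regular_fun_def by auto
  have "(g x * h x) * f x ^ (k + l) = p x * q x" if "x \<in> E" "f x \<noteq> 0" for x
  proof -
    have "(g x * h x) * f x ^ (k + l) = (g x * f x ^ k) * (h x * f x ^ l)"
      by (simp add: power_add ac_simps)
    then show ?thesis using p(2) q(2) that by simp
  qed
  then show ?thesis
    using poly_fun_mult[OF p(1) q(1)] unfolding regular_fun_def mem_Collect_eq
    by (intro exI[of _ "k + l"] bexI[of _ "\<lambda>x. p x * q x"]) auto
qed

lemma regular_fun_power:
  "h \<in> regular_fun E X f \<Longrightarrow> (\<lambda>x. h x ^ k) \<in> regular_fun E X f"
  by (induction k) (auto intro: regular_fun_const regular_fun_mult)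

lemma regular_fun_inverse: "(\<lambda>x. inverse (f x)) \<in> regular_fun E X f"
  unfolding regular_fun_def
  by (auto intro!: exI[of _ 1] bexI[of _ "\<lambda>_. 1"] poly_fun_const)

lemma regular_fun_sum:
  assumes "f \<in> poly_fun X" "\<And>i. i \<in> I \<Longrightarrow> h i \<in> regular_fun E X f"
  shows "(\<lambda>x. \<Sum>i\<in>I. h i x) \<in> regular_fun E X f"
  using assms(2)
  by (induction I rule: infinite_finite_induct)
    (auto intro: regular_fun_const regular_fun_add[OF assms(1)])

lemma regular_fun_prod:
  assumes "\<And>i. i \<in> I \<Longrightarrow> h i \<in> regular_fun E X f"
  shows "(\<lambda>x. \<Prod>i\<in>I. h i x) \<in> regular_fun E X f"
  using assms
  by (induction I rule: infinite_finite_induct) (auto intro: regular_fun_const regular_fun_mult)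

lemma regular_fun_pullback:
  assumes f: "f \<in> poly_fun X" and g: "g \<in> poly_fun Y"
    and \<phi>: "\<And>c. c \<in> Y \<Longrightarrow> (\<lambda>x. c (\<phi> x)) \<in> regular_fun E X f"
  shows "(\<lambda>x. g (\<phi> x)) \<in> regular_fun E X f"
  using g
  by induction (auto intro: regular_fun_const regular_fun_mult regular_fun_add[OF f] \<phi>)

text \<open>
  A map with regular coordinates is continuous: a basic open set \<open>{g \<noteq> 0}\<close> pulls back to the
  nonvanishing locus of a numerator of \<open>g \<circ> \<phi>\<close>.
\<close>

lemma continuous_map_zariski:
  assumes f: "f \<in> poly_fun X"
    and mem: "\<And>x. x \<in> E \<Longrightarrow> f x \<noteq> 0 \<Longrightarrow> \<phi> x \<in> E'"
    and reg: "\<And>c. c \<in> Y \<Longrightarrow> (\<lambda>x. c (\<phi> x)) \<in> regular_fun E X f"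
  shows "continuous_map (subtopology (zariski E X) {x \<in> E. f x \<noteq> 0}) (zariski E' Y) \<phi>"
  unfolding continuous_map_def
proof (intro conjI allI impI)
  show "\<phi> \<in> topspace (subtopology (zariski E X) {x \<in> E. f x \<noteq> 0}) \<rightarrow> topspace (zariski E' Y)"
    using mem by (auto simp: topspace_zariski)
next
  let ?D = "{x \<in> E. f x \<noteq> 0}"
  fix U assume "openin (zariski E' Y) U"
  then obtain G where G: "G \<subseteq> poly_fun Y" and U: "U = {y \<in> E'. \<exists>g\<in>G. g y \<noteq> 0}"
    unfolding openin_zariski by blast
  have "\<exists>k. \<exists>q \<in> poly_fun X. \<forall>x\<in>E. f x \<noteq> 0 \<longrightarrow> g (\<phi> x) * f x ^ k = q x" if "g \<in> G" for g
  proof -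
    have "g \<in> poly_fun Y" using that G by (rule rev_subsetD)
    then have "(\<lambda>x. g (\<phi> x)) \<in> regular_fun E X f" by (rule regular_fun_pullback[OF f _ reg])
    then show ?thesis by (simp add: regular_fun_def)
  qed
  then obtain k q where q: "\<And>g. g \<in> G \<Longrightarrow> q g \<in> poly_fun X"
    and eq: "\<And>g x. g \<in> G \<Longrightarrow> x \<in> E \<Longrightarrow> f x \<noteq> 0 \<Longrightarrow> g (\<phi> x) * f x ^ k g = q g x"
    by metis
  have "{x \<in> ?D. \<phi> x \<in> U} = {x \<in> E. \<exists>h \<in> q ` G. h x \<noteq> 0} \<inter> ?D"
  proof (intro equalityI subsetI)
    fix x assume "x \<in> {x \<in> ?D. \<phi> x \<in> U}"
    then obtain g where x: "x \<in> E" "f x \<noteq> 0" "g \<in> G" "g (\<phi> x) \<noteq> 0" unfolding U by blast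
    then have "q g x \<noteq> 0" using eq[of g x] by (metis mult_eq_0_iff power_not_zero)
    then show "x \<in> {x \<in> E. \<exists>h \<in> q ` G. h x \<noteq> 0} \<inter> ?D" using x by blast
  next
    fix x assume "x \<in> {x \<in> E. \<exists>h \<in> q ` G. h x \<noteq> 0} \<inter> ?D"
    then obtain g where x: "x \<in> E" "f x \<noteq> 0" "g \<in> G" "q g x \<noteq> 0" by blast
    then have "g (\<phi> x) \<noteq> 0" using eq[of g x] by (metis mult_zero_left)
    moreover have "\<phi> x \<in> E'" using mem x(1,2) .
    ultimately have "\<phi> x \<in> U" using x(3) unfolding U by blast
    then show "x \<in> {x \<in> ?D. \<phi> x \<in> U}" using x(1,2) by simp
  qed
  moreover have "openin (zariski E X) {x \<in> E. \<exists>h \<in> q ` G. h x \<noteq> 0}"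
    unfolding openin_zariski using q by (intro exI[of _ "q ` G"]) auto
  ultimately have "openin (subtopology (zariski E X) ?D) {x \<in> ?D. \<phi> x \<in> U}"
    by (simp only: openin_subtopology_Int)
  moreover have "topspace (subtopology (zariski E X) ?D) = ?D"
    by (auto simp: topspace_zariski)
  ultimately show "openin (subtopology (zariski E X) ?D)
     {x \<in> topspace (subtopology (zariski E X) ?D). \<phi> x \<in> U}" by simp
qed

lemma closedin_zariski_point:
  fixes X :: "('a \<Rightarrow> 'k :: field) set"
  assumes x: "x \<in> E" and sep: "\<And>y. y \<in> E \<Longrightarrow> (\<And>c. c \<in> X \<Longrightarrow> c y = c x) \<Longrightarrow> y = x"
  shows "closedin (zariski E X) {x}"
proof -
  have "E - {x} = {y \<in> E. \<exists>h \<in> (\<lambda>c y. c y + (- c x)) ` X. h y \<noteq> 0}"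
    using sep by auto
  moreover have "(\<lambda>c y. c y + (- c x)) ` X \<subseteq> poly_fun X"
    by (auto simp del: add_uminus_conv_diff intro!: poly_fun_add intro: poly_fun_coord poly_fun_const)
  ultimately have "openin (zariski E X) (E - {x})"
    unfolding openin_zariski by blast
  then show ?thesis using x unfolding closedin_def by (simp add: topspace_zariski)
qed

section \<open>Topological invariance of the Krull dimension\<close>

lemma irreducible_closedin_homeomorphic_image:
  assumes h: "homeomorphic_map X Y h" and Z: "irreducible_closedin X Z"
  shows "irreducible_closedin Y (h ` Z)"
proof -
  obtain k where hk: "homeomorphic_maps X Y h k" using h homeomorphic_map_maps by blast
  then have k: "homeomorphic_map Y X k" using homeomorphic_maps_map by blast
  have ZX: "Z \<subseteq> topspace X" using Z closedin_subset unfolding irreducible_closedin_def by blast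
  have kh: "k (h x) = x" if "x \<in> topspace X" for x
    using hk that unfolding homeomorphic_maps_def by blast
  have hk': "h (k y) = y" if "y \<in> topspace Y" for y
    using hk that unfolding homeomorphic_maps_def by blast
  have clk: "closedin X (k ` S)" if "closedin Y S" for S
    using homeomorphic_map_closedness[OF k closedin_subset[OF that]] that by simp
  show ?thesis unfolding irreducible_closedin_def
  proof (intro conjI allI impI)
    show "closedin Y (h ` Z)"
      using homeomorphic_map_closedness[OF h ZX] Z unfolding irreducible_closedin_def by simp
    show "h ` Z \<noteq> {}" using Z unfolding irreducible_closedin_def by blast
    fix S T assume S: "closedin Y S" and T: "closedin Y T" and sub: "h ` Z \<subseteq> S \<union> T"
    have "Z \<subseteq> k ` S \<union> k ` T"
    proof
      fix z assume "z \<in> Z"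
      then have "h z \<in> S \<union> T" "k (h z) = z" using sub kh ZX by blast+
      then show "z \<in> k ` S \<union> k ` T" by (metis UnCI UnE imageI)
    qed
    then have "Z \<subseteq> k ` S \<or> Z \<subseteq> k ` T"
      using Z clk[OF S] clk[OF T] unfolding irreducible_closedin_def by blast
    moreover have "h ` (k ` W) = W" if "closedin Y W" for W
      using closedin_subset[OF that] hk' by (force simp: image_image)
    ultimately show "h ` Z \<subseteq> S \<or> h ` Z \<subseteq> T"
      using S T by (metis image_mono)
  qed
qed

lemma krull_dim_le_homeomorphic_map:
  assumes h: "homeomorphic_map X Y h"
  shows "krull_dim X \<le> krull_dim Y"
  unfolding krull_dim_def
proof (rule Sup_subset_mono, safe)
  fix r :: nat and Z :: "nat \<Rightarrow> 'a set"
  assume Z: "\<forall>i\<le>r. irreducible_closedin X (Z i)" "\<forall>i<r. Z i \<subset> Z (Suc i)"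
  have inj: "inj_on h (topspace X)" using h homeomorphic_imp_injective_map by blast
  have sub: "Z i \<subseteq> topspace X" if "i \<le> r" for i
    using Z(1) that closedin_subset unfolding irreducible_closedin_def by blast
  have "\<forall>i<r. h ` Z i \<subset> h ` Z (Suc i)"
    using Z(2) sub by (meson Suc_leI image_strict_mono inj inj_on_subset)
  then show "\<exists>r'. enat r = enat r' \<and> (\<exists>Z. (\<forall>i\<le>r'. irreducible_closedin Y (Z i)) \<and> (\<forall>i<r'. Z i \<subset> Z (Suc i)))"
    using irreducible_closedin_homeomorphic_image[OF h] Z(1)
    by (intro exI[of _ r] conjI refl exI[of _ "\<lambda>i. h ` Z i"]) auto
qed

lemma krull_dim_homeomorphic:
  assumes "X homeomorphic_space Y"
  shows "krull_dim X = krull_dim Y"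
  using assms homeomorphic_space_sym
  by (metis krull_dim_le_homeomorphic_map homeomorphic_space order_antisym)


section \<open>Matrices of regular functions\<close>

definition regular_mat ::
    "'a set \<Rightarrow> ('a \<Rightarrow> 'k) set \<Rightarrow> ('a \<Rightarrow> 'k) \<Rightarrow> nat \<Rightarrow> nat \<Rightarrow> ('a \<Rightarrow> 'k :: field mat) \<Rightarrow> bool" where
  "regular_mat E X f r c \<phi> \<longleftrightarrow>
     (\<forall>x\<in>E. f x \<noteq> 0 \<longrightarrow> \<phi> x \<in> carrier_mat r c) \<and>
     (\<forall>i<r. \<forall>j<c. (\<lambda>x. \<phi> x $$ (i, j)) \<in> regular_fun E X f)"

lemma regular_matI:
  assumes "\<And>x. x \<in> E \<Longrightarrow> f x \<noteq> 0 \<Longrightarrow> \<phi> x \<in> carrier_mat r c"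
    and "\<And>i j. i < r \<Longrightarrow> j < c \<Longrightarrow> (\<lambda>x. \<phi> x $$ (i, j)) \<in> regular_fun E X f"
  shows "regular_mat E X f r c \<phi>"
  using assms unfolding regular_mat_def by blast

lemma regular_mat_carrier:
  "regular_mat E X f r c \<phi> \<Longrightarrow> x \<in> E \<Longrightarrow> f x \<noteq> 0 \<Longrightarrow> \<phi> x \<in> carrier_mat r c"
  unfolding regular_mat_def by blast

lemma regular_mat_entry:
  "regular_mat E X f r c \<phi> \<Longrightarrow> i < r \<Longrightarrow> j < c \<Longrightarrow> (\<lambda>x. \<phi> x $$ (i, j)) \<in> regular_fun E X f"
  unfolding regular_mat_def by blast

lemma regular_mat_cong:
  assumes \<phi>: "regular_mat E X f r c \<phi>" and eq: "\<And>x. x \<in> E \<Longrightarrow> f x \<noteq> 0 \<Longrightarrow> \<psi> x = \<phi> x"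
  shows "regular_mat E X f r c \<psi>"
proof (rule regular_matI)
  fix x assume "x \<in> E" "f x \<noteq> 0"
  then show "\<psi> x \<in> carrier_mat r c" using regular_mat_carrier[OF \<phi>] eq by simp
next
  fix i j assume "i < r" "j < c"
  from regular_mat_entry[OF \<phi> this] show "(\<lambda>x. \<psi> x $$ (i, j)) \<in> regular_fun E X f"
    by (rule regular_fun_cong) (simp add: eq)
qed

lemma regular_mat_const: "A \<in> carrier_mat r c \<Longrightarrow> regular_mat E X f r c (\<lambda>_. A)"
  by (rule regular_matI) (auto intro: regular_fun_const)

lemma regular_mat_mult:
  assumes f: "f \<in> poly_fun X"
    and \<phi>: "regular_mat E X f r s \<phi>" and \<psi>: "regular_mat E X f s c \<psi>"
  shows "regular_mat E X f r c (\<lambda>x. \<phi> x * \<psi> x)"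
proof (rule regular_matI)
  fix x assume "x \<in> E" "f x \<noteq> 0"
  then have "\<phi> x \<in> carrier_mat r s" "\<psi> x \<in> carrier_mat s c"
    by (rule regular_mat_carrier[OF \<phi>], rule regular_mat_carrier[OF \<psi>])
  then show "\<phi> x * \<psi> x \<in> carrier_mat r c" by (rule mult_carrier_mat)
next
  fix i j assume ij: "i < r" "j < c"
  have "(\<lambda>x. \<Sum>k\<in>{0..<s}. \<phi> x $$ (i, k) * \<psi> x $$ (k, j)) \<in> regular_fun E X f"
    using ij by (intro regular_fun_sum[OF f] regular_fun_mult
        regular_mat_entry[OF \<phi>] regular_mat_entry[OF \<psi>]) auto
  then show "(\<lambda>x. (\<phi> x * \<psi> x) $$ (i, j)) \<in> regular_fun E X f"
  proof (rule regular_fun_cong)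
    fix x assume "x \<in> E" "f x \<noteq> 0"
    then have "\<phi> x \<in> carrier_mat r s" "\<psi> x \<in> carrier_mat s c"
      by (rule regular_mat_carrier[OF \<phi>], rule regular_mat_carrier[OF \<psi>])
    then show "(\<phi> x * \<psi> x) $$ (i, j) = (\<Sum>k\<in>{0..<s}. \<phi> x $$ (i, k) * \<psi> x $$ (k, j))"
      using ij by (auto simp: scalar_prod_def)
  qed
qed

lemma regular_mat_pow:
  assumes f: "f \<in> poly_fun X" and \<phi>: "regular_mat E X f n n \<phi>"
  shows "regular_mat E X f n n (\<lambda>x. \<phi> x ^\<^sub>m k)"
proof (induction k)
  case 0
  show ?case
    by (rule regular_mat_cong[OF regular_mat_const[OF one_carrier_mat]])
      (use regular_mat_carrier[OF \<phi>] in \<open>auto dest: carrier_matD\<close>)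
next
  case (Suc k)
  show ?case using regular_mat_mult[OF f Suc \<phi>] by simp
qed

lemma regular_mat_smult:
  assumes h: "h \<in> regular_fun E X f" and \<phi>: "regular_mat E X f r c \<phi>"
  shows "regular_mat E X f r c (\<lambda>x. h x \<cdot>\<^sub>m \<phi> x)"
proof (rule regular_matI)
  fix x assume "x \<in> E" "f x \<noteq> 0"
  then show "h x \<cdot>\<^sub>m \<phi> x \<in> carrier_mat r c" using regular_mat_carrier[OF \<phi>] by simp
next
  fix i j assume ij: "i < r" "j < c"
  from regular_fun_mult[OF h regular_mat_entry[OF \<phi> ij]]
  show "(\<lambda>x. (h x \<cdot>\<^sub>m \<phi> x) $$ (i, j)) \<in> regular_fun E X f"
    by (rule regular_fun_cong) (use carrier_matD[OF regular_mat_carrier[OF \<phi>]] ij in simp)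
qed

lemma regular_fun_det:
  assumes f: "f \<in> poly_fun X" and \<phi>: "regular_mat E X f n n \<phi>"
  shows "(\<lambda>x. det (\<phi> x)) \<in> regular_fun E X f"
proof -
  have "(\<lambda>x. \<Sum>q\<in>{q. q permutes {0..<n}}. signof q * (\<Prod>i\<in>{0..<n}. \<phi> x $$ (i, q i)))
      \<in> regular_fun E X f"
    by (intro regular_fun_sum[OF f] regular_fun_mult regular_fun_prod regular_fun_const
        regular_mat_entry[OF \<phi>]) (auto simp: permutes_in_image[THEN iffD2] dest: permutes_in_image)
  then show ?thesis
    by (rule regular_fun_cong) (rule det_def'[OF regular_mat_carrier[OF \<phi>]])
qed

lemma regular_mat_adj:
  assumes f: "f \<in> poly_fun X" and \<phi>: "regular_mat E X f n n \<phi>"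
  shows "regular_mat E X f n n (\<lambda>x. adj_mat (\<phi> x))"
proof (rule regular_matI)
  fix x assume "x \<in> E" "f x \<noteq> 0"
  then show "adj_mat (\<phi> x) \<in> carrier_mat n n" by (rule adj_mat(1)[OF regular_mat_carrier[OF \<phi>]])
next
  fix i j assume ij: "i < n" "j < n"
  have del: "mat_delete (\<phi> x) j i $$ (a, b)
      = \<phi> x $$ (if a < j then a else Suc a, if b < i then b else Suc b)"
    if "x \<in> E" "f x \<noteq> 0" "a < n - 1" "b < n - 1" for x a b
    using regular_mat_carrier[OF \<phi> that(1,2)] that(3,4) unfolding mat_delete_def by auto
  have minor: "regular_mat E X f (n - 1) (n - 1) (\<lambda>x. mat_delete (\<phi> x) j i)"
  proof (rule regular_matI)
    fix x assume "x \<in> E" "f x \<noteq> 0"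
    then show "mat_delete (\<phi> x) j i \<in> carrier_mat (n - 1) (n - 1)"
      by (rule mat_delete_carrier[OF regular_mat_carrier[OF \<phi>]])
  next
    fix a b assume ab: "a < n - 1" "b < n - 1"
    show "(\<lambda>x. mat_delete (\<phi> x) j i $$ (a, b)) \<in> regular_fun E X f"
      by (rule regular_fun_cong[OF regular_mat_entry[OF \<phi>]]) (use ab ij del in auto)
  qed
  have "(\<lambda>x. (-1) ^ (j + i) * det (mat_delete (\<phi> x) j i)) \<in> regular_fun E X f"
    by (intro regular_fun_mult regular_fun_const regular_fun_det[OF f minor])
  then show "(\<lambda>x. adj_mat (\<phi> x) $$ (i, j)) \<in> regular_fun E X f"
    by (rule regular_fun_cong)
      (use ij carrier_matD[OF regular_mat_carrier[OF \<phi>]] in \<open>simp add: adj_mat_def cofactor_def\<close>)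
qed

definition cramer_inverse :: "'k :: field mat \<Rightarrow> 'k mat" where
  "cramer_inverse A = inverse (det A) \<cdot>\<^sub>m adj_mat A"

lemma cramer_inverse:
  assumes A: "A \<in> carrier_mat n n" and d: "det A \<noteq> 0"
  shows "cramer_inverse A \<in> carrier_mat n n" "A * cramer_inverse A = 1\<^sub>m n"
    "cramer_inverse A * A = 1\<^sub>m n"
proof -
  note adj = adj_mat[OF A]
  show "cramer_inverse A \<in> carrier_mat n n" using adj by (simp add: cramer_inverse_def)
  have "A * cramer_inverse A = inverse (det A) \<cdot>\<^sub>m (A * adj_mat A)"
    unfolding cramer_inverse_def by (rule mult_smult_distrib[OF A adj(1)])
  also have "\<dots> = 1\<^sub>m n" using d by (auto simp: adj(2))
  finally show "A * cramer_inverse A = 1\<^sub>m n" .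
  then show "cramer_inverse A * A = 1\<^sub>m n"
    by (rule mat_mult_left_right_inverse[OF A \<open>cramer_inverse A \<in> carrier_mat n n\<close>])
qed

text \<open>
  The inverse of a matrix of regular functions with determinant \<open>f\<close> is again regular on \<open>{f \<noteq> 0}\<close>,
  since its entries are minors divided by \<open>f\<close>.
\<close>

lemma regular_mat_cramer_inverse:
  assumes f: "f \<in> poly_fun X" and \<phi>: "regular_mat E X f n n \<phi>"
    and d: "\<And>x. x \<in> E \<Longrightarrow> f x \<noteq> 0 \<Longrightarrow> det (\<phi> x) = f x"
  shows "regular_mat E X f n n (\<lambda>x. cramer_inverse (\<phi> x))"
  unfolding cramer_inverse_def
proof (rule regular_mat_smult[OF _ regular_mat_adj[OF f \<phi>]])
  show "(\<lambda>x. inverse (det (\<phi> x))) \<in> regular_fun E X f"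
    by (rule regular_fun_cong[OF regular_fun_inverse]) (simp add: d)
qed

section \<open>The exchange lemma\<close>

text \<open>
  Laplace expansion along row \<open>k\<close>: its cofactors ignore that row, so they can be taken from any
  matrix that agrees elsewhere.
\<close>

lemma det_replace_row:
  fixes M :: "'a :: comm_ring_1 mat"
  assumes M: "M \<in> carrier_mat n n" and N: "N \<in> carrier_mat n n" and k: "k < n"
    and same: "\<And>i. i < n \<Longrightarrow> i \<noteq> k \<Longrightarrow> row N i = row M i"
  shows "det N = row N k \<bullet> col (adj_mat M) k"
proof -
  have "mat_delete N k j = mat_delete M k j" if "j < n" for j
  proof (rule eq_matI)
    fix a b assume ab: "a < dim_row (mat_delete M k j)" "b < dim_col (mat_delete M k j)"
    then have ab': "a < n - 1" "b < n - 1" using M by auto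
    have "N $$ (i, l) = M $$ (i, l)" if "i < n" "i \<noteq> k" "l < n" for i l
      using same[OF that(1,2)] that M N by (metis carrier_matD index_row(1))
    then show "mat_delete N k j $$ (a, b) = mat_delete M k j $$ (a, b)"
      using ab' M N that k by (auto simp: mat_delete_def)
  qed (use M N in auto)
  then have "det N = (\<Sum>j<n. N $$ (k, j) * cofactor M k j)"
    using laplace_expansion_row[OF N k] by (simp add: cofactor_def)
  also have "\<dots> = row N k \<bullet> col (adj_mat M) k"
    using M N k by (auto simp: scalar_prod_def adj_mat_def atLeast0LessThan intro!: sum.cong)
  finally show ?thesis .
qed

text \<open>
  Steinitz exchange, phrased with an invertible matrix and its inverse: among the invertible
  matrices take one with the most rows in \<open>F\<close>.  If row \<open>i\<close> is not in \<open>F\<close> and some \<open>v \<in> F\<close> has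
  \<open>v \<bullet> col N i \<noteq> 0\<close>, then putting \<open>v\<close> into row \<open>i\<close> keeps the determinant nonzero and gains a row.
  It is used in two ways: for a subspace \<open>F\<close> it yields an adapted basis, and for a family \<open>F\<close> with
  trivial annihilator it selects \<open>n\<close> members that form an invertible matrix.
\<close>

lemma exchange_basis:
  fixes F :: "'k :: field vec set"
  assumes F: "F \<subseteq> carrier_vec n"
  obtains M N where "M \<in> carrier_mat n n" "N \<in> carrier_mat n n" "M * N = 1\<^sub>m n" "N * M = 1\<^sub>m n"
    "\<And>i. i < n \<Longrightarrow> row M i \<in> F \<or> (\<forall>v\<in>F. v \<bullet> col N i = 0)"
proof -
  define P where "P M \<longleftrightarrow> M \<in> carrier_mat n n \<and> det M \<noteq> 0" for M :: "'k mat"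
  define c where "c M = card {i. i < n \<and> row M i \<in> F}" for M :: "'k mat"
  have "\<exists>M. P M \<and> (\<forall>N. P N \<longrightarrow> c N \<le> c M)"
  proof (rule ex_has_greatest_nat[of P "1\<^sub>m n" c "Suc n"])
    show "P (1\<^sub>m n)" by (simp add: P_def)
    have "c N \<le> card {..<n}" for N unfolding c_def by (intro card_mono) auto
    then show "\<forall>N. P N \<longrightarrow> c N < Suc n" by (simp add: less_Suc_eq_le)
  qed
  then obtain M where M: "M \<in> carrier_mat n n" "det M \<noteq> 0" and max: "\<And>N. P N \<Longrightarrow> c N \<le> c M"
    unfolding P_def by blast
  let ?N = "cramer_inverse M"
  have "row M i \<in> F \<or> (\<forall>v\<in>F. v \<bullet> col ?N i = 0)" if i: "i < n" for i
  proof (rule ccontr)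
    assume "\<not> ?thesis"
    then obtain v where v: "v \<in> F" "v \<bullet> col ?N i \<noteq> 0" and nF: "row M i \<notin> F" by blast
    have vc: "v \<in> carrier_vec n" using F v(1) by blast
    define M' where "M' = mat n n (\<lambda>(a, b). if a = i then v $ b else M $$ (a, b))"
    have M': "M' \<in> carrier_mat n n" by (simp add: M'_def)
    have row_i: "row M' i = v" using i vc by (intro eq_vecI) (auto simp: M'_def)
    have row_other: "row M' a = row M a" if "a < n" "a \<noteq> i" for a
      using that M(1) by (intro eq_vecI) (auto simp: M'_def)
    have "col ?N i = inverse (det M) \<cdot>\<^sub>v col (adj_mat M) i"
      using i adj_mat(1)[OF M(1)] by (intro eq_vecI) (auto simp: cramer_inverse_def)
    then have "v \<bullet> col (adj_mat M) i \<noteq> 0"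
      using v(2) vc adj_mat(1)[OF M(1)] i by auto
    then have "det M' \<noteq> 0"
      using det_replace_row[OF M(1) M' i row_other] row_i by simp
    then have "c M' \<le> c M" using max M' by (simp add: P_def)
    moreover have "{a. a < n \<and> row M a \<in> F} \<subset> {a. a < n \<and> row M' a \<in> F}"
      using row_i row_other nF v(1) i by fastforce
    then have "c M < c M'" unfolding c_def by (intro psubset_card_mono) auto
    ultimately show False by simp
  qed
  then show thesis by (rule that[OF M(1) cramer_inverse[OF M]])
qed


section \<open>The action on the space of systems\<close>

lemma GL_carrier_det: "carrier (GL n :: 'k :: field mat monoid) = {g \<in> carrier_mat n n. det g \<noteq> 0}"
proof -
  have "carrier (GL n :: 'k mat monoid) = Units (ring_mat TYPE('k) n ())"
    by (simp add: GL_def units_of_carrier)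
  also have "\<dots> = {g \<in> carrier_mat n n. det g \<noteq> 0}"
  proof (intro equalityI subsetI)
    fix g :: "'k mat" assume g: "g \<in> Units (ring_mat TYPE('k) n ())"
    then have "g \<in> carrier_mat n n" by (simp add: Units_def ring_mat_simps)
    then show "g \<in> {g \<in> carrier_mat n n. det g \<noteq> 0}" using unit_imp_det_non_zero[OF g] by simp
  next
    fix g :: "'k mat" assume "g \<in> {g \<in> carrier_mat n n. det g \<noteq> 0}"
    then show "g \<in> Units (ring_mat TYPE('k) n ())" by (auto intro: det_non_zero_imp_unit)
  qed
  finally show ?thesis .
qed

lemma GL_inverse_pair:
  fixes g h :: "'k :: field mat"
  assumes g: "g \<in> carrier_mat n n" and h: "h \<in> carrier_mat n n" and gh: "g * h = 1\<^sub>m n"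
  shows "g \<in> carrier (GL n)" "inv\<^bsub>GL n\<^esub> g = h"
proof -
  interpret group "GL n :: 'k mat monoid" by (rule group_GL)
  have hg: "h * g = 1\<^sub>m n" by (rule mat_mult_left_right_inverse[OF g h gh])
  have "det g * det h = 1" using det_mult[OF g h] gh by simp
  then have "det g \<noteq> 0" "det h \<noteq> 0" by auto
  then show G: "g \<in> carrier (GL n)" using g by (simp add: GL_carrier_det)
  have "h \<in> carrier (GL n)" using h \<open>det h \<noteq> 0\<close> by (simp add: GL_carrier_det)
  then show "inv\<^bsub>GL n\<^esub> g = h" using G hg by (intro inv_equality) (simp_all add: GL_simps)
qed

lemma lds_act_inverse_pair:
  fixes g h :: "'k :: field mat"
  assumes "g \<in> carrier_mat n n" "h \<in> carrier_mat n n" "g * h = 1\<^sub>m n" "x \<in> lds_space n m p"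
  shows "lds_act n m p g x
    = (g * fst x * h, g * fst (snd x), fst (snd (snd x)) * h, snd (snd (snd x)))"
  using assms(4) unfolding lds_act_def by (auto simp: GL_inverse_pair(2)[OF assms(1-3)] case_prod_beta)

lemma lds_space_carrier:
  assumes "x \<in> lds_space n m p"
  shows "fst x \<in> carrier_mat n n" "fst (snd x) \<in> carrier_mat n m"
    "fst (snd (snd x)) \<in> carrier_mat p n" "snd (snd (snd x)) \<in> carrier_mat p m"
  using assms by (auto simp: lds_space_def)

text \<open>
  The coordinate functions written with projections instead of tuple patterns, so that they compose
  with maps into the space of systems.
\<close>

lemma lds_coords_eq:
  "lds_coords n m p =
     {\<lambda>x. fst x $$ (i, j) | i j. i < n \<and> j < n} \<union>
     {\<lambda>x. fst (snd x) $$ (i, j) | i j. i < n \<and> j < m} \<union>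
     {\<lambda>x. fst (snd (snd x)) $$ (i, j) | i j. i < p \<and> j < n} \<union>
     {\<lambda>x. snd (snd (snd x)) $$ (i, j) | i j. i < p \<and> j < m}"
  unfolding lds_coords_def case_prod_unfold ..

lemma lds_coordsI:
  "i < n \<Longrightarrow> j < n \<Longrightarrow> (\<lambda>x. fst x $$ (i, j)) \<in> lds_coords n m p"
  "i < n \<Longrightarrow> j < m \<Longrightarrow> (\<lambda>x. fst (snd x) $$ (i, j)) \<in> lds_coords n m p"
  "i < p \<Longrightarrow> j < n \<Longrightarrow> (\<lambda>x. fst (snd (snd x)) $$ (i, j)) \<in> lds_coords n m p"
  "i < p \<Longrightarrow> j < m \<Longrightarrow> (\<lambda>x. snd (snd (snd x)) $$ (i, j)) \<in> lds_coords n m p"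
  unfolding lds_coords_eq by blast+

lemma lds_coordsE:
  assumes "c \<in> lds_coords n m p"
  obtains i j where "i < n" "j < n" "c = (\<lambda>x. fst x $$ (i, j))"
  | i j where "i < n" "j < m" "c = (\<lambda>x. fst (snd x) $$ (i, j))"
  | i j where "i < p" "j < n" "c = (\<lambda>x. fst (snd (snd x)) $$ (i, j))"
  | i j where "i < p" "j < m" "c = (\<lambda>x. snd (snd (snd x)) $$ (i, j))"
  using assms unfolding lds_coords_eq by blast

lemma regular_mat_lds:
  "regular_mat (lds_space n m p) (lds_coords n m p) f n n fst"
  "regular_mat (lds_space n m p) (lds_coords n m p) f n m (\<lambda>x. fst (snd x))"
  "regular_mat (lds_space n m p) (lds_coords n m p) f p n (\<lambda>x. fst (snd (snd x)))"
  "regular_mat (lds_space n m p) (lds_coords n m p) f p m (\<lambda>x. snd (snd (snd x)))"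
  by (rule regular_matI, erule lds_space_carrier, intro regular_fun_coord lds_coordsI, assumption+)+

lemma regular_fun_lds_coords:
  assumes "regular_mat E X f n n (\<lambda>x. fst (\<phi> x))"
    and "regular_mat E X f n m (\<lambda>x. fst (snd (\<phi> x)))"
    and "regular_mat E X f p n (\<lambda>x. fst (snd (snd (\<phi> x))))"
    and "regular_mat E X f p m (\<lambda>x. snd (snd (snd (\<phi> x))))"
    and "c \<in> lds_coords n m p"
  shows "(\<lambda>x. c (\<phi> x)) \<in> regular_fun E X f"
  using assms(5)
  by (cases rule: lds_coordsE) (use assms(1-4) in \<open>auto dest: regular_mat_entry\<close>)

lemma lds_coords_separate:
  assumes y: "y \<in> lds_space n m p" and z: "z \<in> lds_space n m p"
    and eq: "\<And>c. c \<in> lds_coords n m p \<Longrightarrow> c y = c z"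
  shows "y = z"
proof -
  note cy = lds_space_carrier[OF y] and cz = lds_space_carrier[OF z]
  have "fst y = fst z"
    using eq[OF lds_coordsI(1)] cy(1) cz(1) by (intro eq_matI) auto
  moreover have "fst (snd y) = fst (snd z)"
    using eq[OF lds_coordsI(2)] cy(2) cz(2) by (intro eq_matI) auto
  moreover have "fst (snd (snd y)) = fst (snd (snd z))"
    using eq[OF lds_coordsI(3)] cy(3) cz(3) by (intro eq_matI) auto
  moreover have "snd (snd (snd y)) = snd (snd (snd z))"
    using eq[OF lds_coordsI(4)] cy(4) cz(4) by (intro eq_matI) auto
  ultimately show "y = z" by (simp add: prod_eq_iff)
qed

lemma regular_fun_lds_act:
  assumes f: "f \<in> poly_fun X"
    and g: "regular_mat E X f n n g" and h: "regular_mat E X f n n h"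
    and inverse: "\<And>x. x \<in> E \<Longrightarrow> f x \<noteq> 0 \<Longrightarrow> g x * h x = 1\<^sub>m n"
    and mem: "\<And>x. x \<in> E \<Longrightarrow> f x \<noteq> 0 \<Longrightarrow> \<phi> x \<in> lds_space n m p"
    and A: "regular_mat E X f n n (\<lambda>x. fst (\<phi> x))"
    and B: "regular_mat E X f n m (\<lambda>x. fst (snd (\<phi> x)))"
    and C: "regular_mat E X f p n (\<lambda>x. fst (snd (snd (\<phi> x))))"
    and D: "regular_mat E X f p m (\<lambda>x. snd (snd (snd (\<phi> x))))"
    and c: "c \<in> lds_coords n m p"
  shows "(\<lambda>x. c (lds_act n m p (g x) (\<phi> x))) \<in> regular_fun E X f"
proof -
  note eq = lds_act_inverse_pair[OF regular_mat_carrier[OF g] regular_mat_carrier[OF h] inverse mem]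
  show ?thesis
  proof (rule regular_fun_lds_coords[OF _ _ _ _ c])
    show "regular_mat E X f n n (\<lambda>x. fst (lds_act n m p (g x) (\<phi> x)))"
      by (rule regular_mat_cong[OF regular_mat_mult[OF f regular_mat_mult[OF f g A] h]]) (simp add: eq)
    show "regular_mat E X f n m (\<lambda>x. fst (snd (lds_act n m p (g x) (\<phi> x))))"
      by (rule regular_mat_cong[OF regular_mat_mult[OF f g B]]) (simp add: eq)
    show "regular_mat E X f p n (\<lambda>x. fst (snd (snd (lds_act n m p (g x) (\<phi> x)))))"
      by (rule regular_mat_cong[OF regular_mat_mult[OF f C h]]) (simp add: eq)
    show "regular_mat E X f p m (\<lambda>x. snd (snd (snd (lds_act n m p (g x) (\<phi> x)))))"
      by (rule regular_mat_cong[OF D]) (simp add: eq)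
  qed
qed

text \<open>
  A trivial stabiliser makes the kernel of the action trivial, and then the projection to the
  cosets is an injective quotient map, hence a homeomorphism.
\<close>

lemma GL_mod_kernel_homeomorphic:
  fixes x :: "'k :: field lds"
  assumes x: "x \<in> lds_space n m p"
    and stab: "\<And>g. g \<in> carrier (GL n) \<Longrightarrow> lds_act n m p g x = x \<Longrightarrow> g = 1\<^sub>m n"
  shows "(GL_mod_kernel n m p :: 'k mat set topology) homeomorphic_space (GL_zariski n :: 'k mat topology)"
proof -
  interpret group "GL n :: 'k mat monoid" by (rule group_GL)
  interpret group_action "GL n" "lds_space n m p :: 'k lds set" "lds_act n m p"
    by (rule group_action_lds_act)
  have ker: "act_kernel n m p = {1\<^sub>m n :: 'k mat}"
  proof
    show "act_kernel n m p \<subseteq> {1\<^sub>m n :: 'k mat}"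
    proof
      fix g :: "'k mat" assume "g \<in> act_kernel n m p"
      then have "g \<in> carrier (GL n)" "lds_act n m p g = (\<lambda>y \<in> lds_space n m p. y)"
        by (auto simp: act_kernel_def kernel_def BijGroup_def)
      then show "g \<in> {1\<^sub>m n}" using stab[of g] x by simp
    qed
    show "{1\<^sub>m n :: 'k mat} \<subseteq> act_kernel n m p"
      using subgroup.one_closed[OF group_hom.subgroup_kernel[OF group_hom]]
      by (simp add: act_kernel_def GL_simps)
  qed
  have coset: "act_kernel n m p #>\<^bsub>GL n\<^esub> g = {g}" if "g \<in> carrier (GL n)" for g :: "'k mat"
    using l_one[OF that] unfolding ker r_coset_def by (simp add: GL_simps)
  have "inj_on (\<lambda>g. act_kernel n m p #>\<^bsub>GL n\<^esub> g) (topspace (GL_zariski n :: 'k mat topology))"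
    by (auto simp: inj_on_def GL_zariski_def coset)
  then have "homeomorphic_map (GL_zariski n) (GL_mod_kernel n m p) (\<lambda>g :: 'k mat. act_kernel n m p #>\<^bsub>GL n\<^esub> g)"
    unfolding GL_mod_kernel_def homeomorphic_map_def
    by (simp add: quotient_map_quotient_topology)
  then show ?thesis
    using homeomorphic_map_imp_homeomorphic_space homeomorphic_space_sym by metis
qed

section \<open>Stability from an equivariant map to the group\<close>

text \<open>
  An equivariant map \<open>\<rho>\<close> from \<open>{f \<noteq> 0}\<close> to the group, regular together with its inverse \<open>\<rho>i\<close>,
  trivialises the action on \<open>{f \<noteq> 0}\<close>: every orbit there meets the slice \<open>{\<rho> = 1}\<close> in exactly one point,
  namely \<open>\<nu> y = \<rho>i y \<cdot> y\<close>, and \<open>\<rho>\<close> restricted to an orbit inverts the orbit map up to a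
  translation.
\<close>

lemma chi_stable_if_slice:
  fixes n m p :: nat and \<Sigma> :: "'k :: field lds"
  defines "E \<equiv> lds_space n m p" and "X \<equiv> lds_coords n m p"
  assumes \<Sigma>: "\<Sigma> \<in> E" and f: "f \<in> poly_fun X" and f\<Sigma>: "f \<Sigma> \<noteq> 0"
    and semi: "\<And>g x. g \<in> carrier (GL n) \<Longrightarrow> x \<in> E \<Longrightarrow> f (lds_act n m p g x) = det g powi \<chi> * f x"
    and \<rho>: "regular_mat E X f n n \<rho>" and \<rho>i: "regular_mat E X f n n \<rho>i"
    and inverse: "\<And>x. x \<in> E \<Longrightarrow> f x \<noteq> 0 \<Longrightarrow> \<rho> x * \<rho>i x = 1\<^sub>m n"
    and equi: "\<And>g x. g \<in> carrier (GL n) \<Longrightarrow> x \<in> E \<Longrightarrow> f x \<noteq> 0 \<Longrightarrow>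
      \<rho> (lds_act n m p g x) = g * \<rho> x"
  shows "chi_stable n m p \<chi> \<Sigma>"
proof -
  let ?D = "{x \<in> E. f x \<noteq> 0}"
  let ?Z = "lds_zariski n m p :: 'k lds topology"
  let ?act = "lds_act n m p :: 'k mat \<Rightarrow> 'k lds \<Rightarrow> 'k lds"
  let ?M = "carrier_mat n n :: 'k mat set" and ?Y = "{\<lambda>g :: 'k mat. g $$ (i, j) | i j. i < n \<and> j < n}"
  have Z: "?Z = zariski E X" by (simp add: lds_zariski_def E_def X_def)
  note c = regular_mat_carrier[OF \<rho>] and ci = regular_mat_carrier[OF \<rho>i]
  have inverse': "\<rho>i x * \<rho> x = 1\<^sub>m n" if "x \<in> E" "f x \<noteq> 0" for x
    using mat_mult_left_right_inverse[OF c[OF that] ci[OF that] inverse[OF that]] .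
  have \<rho>GL: "\<rho> x \<in> carrier (GL n)" and \<rho>iGL: "\<rho>i x \<in> carrier (GL n)" if "x \<in> E" "f x \<noteq> 0" for x
    using GL_inverse_pair(1)[OF c[OF that] ci[OF that] inverse[OF that]]
      GL_inverse_pair(1)[OF ci[OF that] c[OF that] inverse'[OF that]] .
  have act_mem: "?act g x \<in> E" if "g \<in> carrier (GL n)" "x \<in> E" for g x
    using lds_act_closed that unfolding E_def by metis
  have act_nz: "f (?act g x) \<noteq> 0" if "g \<in> carrier (GL n)" "x \<in> E" "f x \<noteq> 0" for g x
    using that semi[OF that(1,2)] by (simp add: GL_carrier_det)
  have act_mult: "?act (g * h) x = ?act g (?act h x)"
    if "g \<in> carrier (GL n)" "h \<in> carrier (GL n)" "x \<in> E" for g h x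
    using lds_act_mult that unfolding E_def by metis
  have act_one: "?act (1\<^sub>m n) x = x" if "x \<in> E" for x
    using lds_act_one that unfolding E_def by metis
  have transl: "\<rho> (?act g x) * \<rho>i x = g" if "g \<in> carrier (GL n)" "x \<in> E" "f x \<noteq> 0" for g x
  proof -
    have "g * \<rho> x * \<rho>i x = g * (\<rho> x * \<rho>i x)"
      by (rule assoc_mult_mat[OF GL_inverse(1)[OF that(1)] c[OF that(2,3)] ci[OF that(2,3)]])
    then show ?thesis using equi[OF that] inverse[OF that(2,3)] GL_inverse(1)[OF that(1)] by simp
  qed

  \<comment> \<open>The retraction onto the slice; its fibres will be the orbits.\<close>
  define \<nu> where "\<nu> y = ?act (\<rho>i y) y" for y
  have \<nu>E: "\<nu> y \<in> E" if "y \<in> ?D" for y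
    using that act_mem \<rho>iGL unfolding \<nu>_def by simp
  have orbit_eq: "orbit (GL n) ?act x = {y \<in> ?D. \<nu> y = \<nu> x}" if x: "x \<in> E" "f x \<noteq> 0" for x
  proof (intro equalityI subsetI)
    fix y assume "y \<in> orbit (GL n) ?act x"
    then obtain g where g: "g \<in> carrier (GL n)" and y: "y = ?act g x"
      unfolding orbit_def by blast
    have yD: "y \<in> E" "f y \<noteq> 0" using act_mem[OF g x(1)] act_nz[OF g x] unfolding y by simp_all
    note cs = c[OF yD] ci[OF yD] c[OF x] ci[OF x] GL_inverse(1)[OF g]
    have "\<rho>i y * g = \<rho>i y * (\<rho> y * \<rho>i x)" using transl[OF g x] y by simp
    also have "\<dots> = \<rho>i y * \<rho> y * \<rho>i x" using cs by (simp add: assoc_mult_mat[of _ n n _ n _ n])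
    also have "\<dots> = \<rho>i x" using inverse'[OF yD] cs by simp
    finally have "\<rho>i y * g = \<rho>i x" .
    then have "\<nu> y = \<nu> x"
      unfolding \<nu>_def using act_mult[OF \<rho>iGL[OF yD] g x(1)] y by simp
    then show "y \<in> {y \<in> ?D. \<nu> y = \<nu> x}" using yD by simp
  next
    fix y assume y: "y \<in> {y \<in> ?D. \<nu> y = \<nu> x}"
    then have yD: "y \<in> E" "f y \<noteq> 0" by auto
    have "y = ?act (\<rho> y * \<rho>i y) y" using inverse[OF yD] act_one[OF yD(1)] by simp
    also have "\<dots> = ?act (\<rho> y) (\<nu> x)"
      using act_mult[OF \<rho>GL[OF yD] \<rho>iGL[OF yD] yD(1)] y by (simp add: \<nu>_def)
    also have "\<dots> = ?act (\<rho> y * \<rho>i x) x"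
      using act_mult[OF \<rho>GL[OF yD] \<rho>iGL[OF x] x(1)] by (simp add: \<nu>_def)
    finally show "y \<in> orbit (GL n) ?act x"
      using group.is_monoid[OF group_GL] monoid.m_closed[of "GL n" "\<rho> y" "\<rho>i x"]
        \<rho>GL[OF yD] \<rho>iGL[OF x] unfolding orbit_def by (auto simp: GL_simps)
  qed

  have \<nu>_cont: "continuous_map (subtopology ?Z ?D) ?Z \<nu>"
    unfolding Z
  proof (rule continuous_map_zariski[OF f])
    show "\<nu> x \<in> E" if "x \<in> E" "f x \<noteq> 0" for x using \<nu>E that by simp
    show "(\<lambda>x. h (\<nu> x)) \<in> regular_fun E X f" if "h \<in> X" for h
      unfolding \<nu>_def using inverse' that unfolding E_def X_def
      by (intro regular_fun_lds_act[OF f[unfolded X_def] \<rho>i[unfolded E_def X_def]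
            \<rho>[unfolded E_def X_def]] regular_mat_lds)
  qed
  have closed: "closedin (subtopology ?Z ?D) (orbit (GL n) ?act x)" if x: "x \<in> E" "f x \<noteq> 0" for x
  proof -
    have "closedin ?Z {\<nu> x}"
      unfolding Z
    proof (rule closedin_zariski_point)
      show \<nu>x: "\<nu> x \<in> E" using \<nu>E x by simp
      show "y = \<nu> x" if "y \<in> E" "\<And>h. h \<in> X \<Longrightarrow> h y = h (\<nu> x)" for y
        by (rule lds_coords_separate[OF that(1)[unfolded E_def] \<nu>x[unfolded E_def] that(2)[unfolded X_def]])
    qed
    from closedin_continuous_map_preimage[OF \<nu>_cont this]
    have "closedin (subtopology ?Z ?D) {y \<in> topspace (subtopology ?Z ?D). \<nu> y = \<nu> x}"
      by (simp only: singleton_iff)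
    moreover have "topspace (subtopology ?Z ?D) = ?D" by (auto simp: Z topspace_zariski)
    ultimately show ?thesis by (simp only: orbit_eq[OF x])
  qed

  let ?O = "orbit (GL n) ?act \<Sigma>"
  have OD: "?O \<subseteq> ?D" using orbit_eq[OF \<Sigma> f\<Sigma>] by blast
  \<comment> \<open>The group is the principal open set \<open>{d \<noteq> 0}\<close> in the space of matrices.\<close>
  have detpoly: "\<exists>d \<in> poly_fun ?Y. \<forall>g \<in> ?M. d g = det g"
  proof -
    have "regular_mat ?M ?Y (\<lambda>_. 1) n n (\<lambda>g. g)"
      by (rule regular_matI) (auto intro!: regular_fun_coord)
    from regular_fun_det[OF poly_fun_const this] show ?thesis
      unfolding regular_fun_def by fastforce
  qed
  then obtain d where d: "d \<in> poly_fun ?Y" "\<And>g. g \<in> ?M \<Longrightarrow> d g = det g" by blast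
  have GLd: "carrier (GL n) = {g \<in> ?M. d g \<noteq> 0}" using d(2) by (auto simp: GL_carrier_det)
  have idreg: "regular_mat ?M ?Y d n n (\<lambda>g. g)"
    by (rule regular_matI) (auto intro!: regular_fun_coord)
  have cont1: "continuous_map (GL_zariski n) (subtopology ?Z ?O) (\<lambda>g. ?act g \<Sigma>)"
  proof (rule continuous_map_into_subtopology)
    show "continuous_map (GL_zariski n) ?Z (\<lambda>g. ?act g \<Sigma>)"
      unfolding Z GL_zariski_def GLd
    proof (rule continuous_map_zariski[OF d(1)])
      show "?act g \<Sigma> \<in> E" if "g \<in> ?M" "d g \<noteq> 0" for g
        using act_mem[OF _ \<Sigma>] that GLd by simp
      show "(\<lambda>g. h (?act g \<Sigma>)) \<in> regular_fun ?M ?Y d" if "h \<in> X" for h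
      proof (rule regular_fun_lds_act[OF d(1) idreg])
        show "regular_mat ?M ?Y d n n cramer_inverse"
          by (rule regular_mat_cramer_inverse[OF d(1) idreg]) (simp add: d(2))
        show "g * cramer_inverse g = 1\<^sub>m n" if "g \<in> ?M" "d g \<noteq> 0" for g
          using cramer_inverse(2) that d(2) by metis
        show "\<Sigma> \<in> lds_space n m p" using \<Sigma> by (simp add: E_def)
        show "h \<in> lds_coords n m p" using that by (simp add: X_def)
      qed (rule regular_mat_const, rule lds_space_carrier[OF \<Sigma>[unfolded E_def]])+
    qed
    show "(\<lambda>g. ?act g \<Sigma>) \<in> topspace (GL_zariski n) \<rightarrow> ?O"
      unfolding GL_zariski_def orbit_def by auto
  qed
  have cont2: "continuous_map (subtopology ?Z ?O) (GL_zariski n) (\<lambda>y. \<rho> y * \<rho>i \<Sigma>)"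
    unfolding GL_zariski_def
  proof (rule continuous_map_into_subtopology)
    have reg: "regular_mat E X f n n (\<lambda>y. \<rho> y * \<rho>i \<Sigma>)"
      by (rule regular_mat_mult[OF f \<rho> regular_mat_const[OF ci[OF \<Sigma> f\<Sigma>]]])
    have "continuous_map (subtopology ?Z ?D) (zariski ?M ?Y) (\<lambda>y. \<rho> y * \<rho>i \<Sigma>)"
      unfolding Z
      by (rule continuous_map_zariski[OF f])
        (use regular_mat_carrier[OF reg] regular_mat_entry[OF reg] in auto)
    then show "continuous_map (subtopology ?Z ?O) (zariski ?M ?Y) (\<lambda>y. \<rho> y * \<rho>i \<Sigma>)"
      using OD by (rule continuous_map_from_subtopology_mono)
    show "(\<lambda>y. \<rho> y * \<rho>i \<Sigma>) \<in> topspace (subtopology ?Z ?O) \<rightarrow> carrier (GL n)"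
      using transl[OF _ \<Sigma> f\<Sigma>] by (auto simp: orbit_def)
  qed
  have "homeomorphic_maps (GL_zariski n) (subtopology ?Z ?O) (\<lambda>g. ?act g \<Sigma>) (\<lambda>y. \<rho> y * \<rho>i \<Sigma>)"
    unfolding homeomorphic_maps_def
    using cont1 cont2 transl[OF _ \<Sigma> f\<Sigma>] by (auto simp: orbit_def GL_zariski_def)
  then have "(GL_zariski n :: 'k mat topology) homeomorphic_space subtopology ?Z ?O"
    by (rule homeomorphic_maps_imp_homeomorphic_space)
  moreover have "(GL_mod_kernel n m p :: 'k mat set topology) homeomorphic_space (GL_zariski n :: 'k mat topology)"
  proof (rule GL_mod_kernel_homeomorphic)
    show "\<Sigma> \<in> lds_space n m p" using \<Sigma> by (simp add: E_def)
    fix g :: "'k mat" assume "g \<in> carrier (GL n)" "?act g \<Sigma> = \<Sigma>"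
    then show "g = 1\<^sub>m n" using transl[OF _ \<Sigma> f\<Sigma>, of g] inverse[OF \<Sigma> f\<Sigma>] by simp
  qed
  ultimately have "krull_dim (subtopology ?Z ?O) = krull_dim (GL_mod_kernel n m p :: 'k mat set topology)"
    using krull_dim_homeomorphic by metis
  then show ?thesis
    unfolding chi_stable_def E_def[symmetric] X_def[symmetric]
    by (intro exI[of _ "1 :: nat"] conjI bexI[of _ f] ballI impI f f\<Sigma> closed)
      (simp_all add: semi)
qed


section \<open>Controllability, observability and degenerations\<close>

lemma is_subspace_iff:
  "is_subspace d U \<longleftrightarrow> U \<subseteq> carrier_vec d \<and> 0\<^sub>v d \<in> U \<and> (\<forall>u\<in>U. \<forall>v\<in>U. u + v \<in> U) \<and>
     (\<forall>c :: 'k :: field. \<forall>u\<in>U. c \<cdot>\<^sub>v u \<in> U)"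
  unfolding is_subspace_def VectorSpace.subspace_def submodule_def
  using vec_vs[where 'a = 'k and n = d] vec_module[where 'a = 'k and n = d]
  by (auto simp: module_vec_simps)

lemma is_subspaceD:
  assumes "is_subspace d U"
  shows "u \<in> U \<Longrightarrow> u \<in> carrier_vec d" "0\<^sub>v d \<in> U" "u \<in> U \<Longrightarrow> v \<in> U \<Longrightarrow> u + v \<in> U"
    "u \<in> U \<Longrightarrow> c \<cdot>\<^sub>v u \<in> U"
  using assms unfolding is_subspace_iff by auto

definition controllable :: "nat \<Rightarrow> nat \<Rightarrow> 'k :: field mat \<Rightarrow> 'k mat \<Rightarrow> bool" where
  "controllable n m A B \<longleftrightarrow>
     (\<forall>U. is_subspace n U \<longrightarrow> (\<forall>u\<in>U. A *\<^sub>v u \<in> U) \<longrightarrow> (\<forall>w\<in>carrier_vec m. B *\<^sub>v w \<in> U) \<longrightarrow>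
        U = carrier_vec n)"

definition observable :: "nat \<Rightarrow> nat \<Rightarrow> 'k :: field mat \<Rightarrow> 'k mat \<Rightarrow> bool" where
  "observable n p A C \<longleftrightarrow>
     (\<forall>U. is_subspace n U \<longrightarrow> (\<forall>u\<in>U. A *\<^sub>v u \<in> U) \<longrightarrow> (\<forall>u\<in>U. C *\<^sub>v u = 0\<^sub>v p) \<longrightarrow>
        U = {0\<^sub>v n})"

text \<open>
  Closure of \<open>U\<close> under linear combinations, by induction on the number of columns used so far.
\<close>

lemma mult_mat_vec_in_subspace:
  assumes U: "is_subspace n U" and S: "S \<in> carrier_mat n k"
    and cols: "\<And>j. j < k \<Longrightarrow> col S j \<in> U" and c: "c \<in> carrier_vec k"
  shows "S *\<^sub>v (c :: 'k :: field vec) \<in> U"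
proof -
  have "vec n (\<lambda>i. \<Sum>j\<in>{0..<l}. S $$ (i, j) * c $ j) \<in> U" if "l \<le> k" for l
    using that
  proof (induction l)
    case 0
    have "vec n (\<lambda>i. \<Sum>j\<in>{0..<0}. S $$ (i, j) * c $ j) = 0\<^sub>v n" by (intro eq_vecI) auto
    then show ?case using is_subspaceD(2)[OF U] by simp
  next
    case (Suc l)
    have "vec n (\<lambda>i. \<Sum>j\<in>{0..<Suc l}. S $$ (i, j) * c $ j)
        = vec n (\<lambda>i. \<Sum>j\<in>{0..<l}. S $$ (i, j) * c $ j) + c $ l \<cdot>\<^sub>v col S l"
      using Suc.prems S by (intro eq_vecI) auto
    then show ?case
      using is_subspaceD(3)[OF U Suc.IH is_subspaceD(4)[OF U cols]] Suc.prems by simp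
  qed
  moreover have "S *\<^sub>v c = vec n (\<lambda>i. \<Sum>j\<in>{0..<k}. S $$ (i, j) * c $ j)"
    using S c by (intro eq_vecI) (auto simp: scalar_prod_def)
  ultimately show ?thesis by simp
qed

lemma poly_fun_line:
  assumes "q \<in> poly_fun {\<lambda>t :: 'k :: comm_ring_1. t}"
  shows "\<exists>P. \<forall>t. q t = poly P t"
  using assms
proof induction
  case (poly_fun_coord h)
  then show ?case by (intro exI[of _ "[:0, 1:]"]) simp
next
  case (poly_fun_const c)
  then show ?case by (intro exI[of _ "[:c:]"]) simp
next
  case (poly_fun_add f g)
  then show ?case by (metis poly_add)
next
  case (poly_fun_mult f g)
  then show ?case by (metis poly_mult)
qed

abbreviation regular_line :: "('k \<Rightarrow> 'k :: field) set" where
  "regular_line \<equiv> regular_fun UNIV {\<lambda>t. t} (\<lambda>_. 1)"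

lemma regular_line_id: "(\<lambda>t. t) \<in> regular_line"
  by (rule regular_fun_coord) simp

lemma regular_line_if: "(\<lambda>t. if b then t else 1) \<in> regular_line"
  by (cases b) (simp_all add: regular_fun_const regular_line_id)

text \<open>
  The degeneration argument: along the curve \<open>y\<close> the product \<open>d t * f (y t)\<close> is a polynomial in
  \<open>t\<close>.  Over an infinite field it is constant once it is constant off the origin, and \<open>d 0 = 0\<close>
  makes that constant zero.
\<close>

lemma semi_invariant_vanishes_in_limit:
  fixes f :: "'a \<Rightarrow> 'k :: field_char_0"
  assumes f: "f \<in> poly_fun X"
    and y: "\<And>c. c \<in> X \<Longrightarrow> (\<lambda>t. c (y t)) \<in> regular_line"
    and d: "d \<in> regular_line" and d0: "d 0 = 0"
    and eq: "\<And>t. t \<noteq> 0 \<Longrightarrow> d t * f (y t) = a"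
  shows "a = 0"
proof -
  have "(\<lambda>t. d t * f (y t)) \<in> regular_line"
    by (intro regular_fun_mult d regular_fun_pullback[OF poly_fun_const f y])
  then obtain q where q: "q \<in> poly_fun {\<lambda>t. t}" "\<And>t. d t * f (y t) = q t"
    unfolding regular_fun_def by auto
  obtain P where P: "\<And>t. q t = poly P t" using poly_fun_line[OF q(1)] by metis
  have "UNIV - {0} \<subseteq> {t. poly (P - [:a:]) t = 0}"
    using eq q(2) P by auto
  moreover have "infinite (UNIV - {0} :: 'k set)"
    by (simp add: infinite_UNIV_char_0)
  ultimately have "P - [:a:] = 0"
    using poly_roots_finite finite_subset by blast
  then have "poly P 0 = a" by simp
  then show ?thesis using q(2)[of 0] P[of 0] d0 by simp
qed

lemma det_mat_diag_eq_0:
  assumes "k < n" "w k = 0"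
  shows "det (mat_diag n w :: 'k :: comm_ring_1 mat) = 0"
proof -
  have "det (mat_diag n w) = (\<Sum>j<n. mat_diag n w $$ (k, j) * cofactor (mat_diag n w) k j)"
    by (rule laplace_expansion_row) (use assms in auto)
  also have "\<dots> = 0" using assms by (intro sum.neutral) (auto simp: mat_diag_def)
  finally show ?thesis .
qed

lemma regular_fun_det_mat_diag:
  assumes f: "f \<in> poly_fun X" and "\<And>i. i < n \<Longrightarrow> (\<lambda>t. w t i) \<in> regular_fun E X f"
  shows "(\<lambda>t. det (mat_diag n (w t))) \<in> regular_fun E X f"
proof (rule regular_fun_det[OF f])
  show "regular_mat E X f n n (\<lambda>t. mat_diag n (w t))"
  proof (rule regular_matI)
    fix i j assume ij: "i < n" "j < n"
    show "(\<lambda>t. mat_diag n (w t) $$ (i, j)) \<in> regular_fun E X f"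
      using assms(2)[OF ij(2)] regular_fun_const[of 0 E X f] ij by (cases "i = j") (simp_all add: mat_diag_def)
  qed simp
qed

lemma det_mat_diag_inverse:
  fixes v w :: "nat \<Rightarrow> 'k :: field"
  assumes "\<And>i. v i * w i = 1"
  shows "mat_diag n v * mat_diag n w = 1\<^sub>m n" "det (mat_diag n v) * det (mat_diag n w) = 1"
proof -
  show *: "mat_diag n v * mat_diag n w = 1\<^sub>m n" using assms by simp
  have "det (mat_diag n v) * det (mat_diag n w) = det (mat_diag n v * mat_diag n w)"
    by (rule det_mult[of _ n, symmetric]) auto
  then show "det (mat_diag n v) * det (mat_diag n w) = 1" by (simp only: * det_one)
qed

text \<open>
  Here \<open>J\<close> indexes a coordinate subspace that is invariant and contains the image of \<open>B\<close>.  Scaling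
  the other coordinates by \<open>1 / t\<close> multiplies the block of \<open>A\<close> with row in \<open>J\<close> and column outside by
  \<open>t\<close>; the opposite block, which would acquire a pole, is zero.
\<close>

lemma semi_invariant_vanishes_reachable_block:
  fixes x :: "'k :: field_char_0 lds"
  assumes f: "f \<in> poly_fun (lds_coords n m p)"
    and semi: "\<And>g x. g \<in> carrier (GL n) \<Longrightarrow> x \<in> lds_space n m p \<Longrightarrow>
      f (lds_act n m p g x) = det g ^ N * f x"
    and N: "N \<ge> 1" and x: "x \<in> lds_space n m p"
    and A: "\<And>i j. i < n \<Longrightarrow> j < n \<Longrightarrow> i \<notin> J \<Longrightarrow> j \<in> J \<Longrightarrow> fst x $$ (i, j) = 0"
    and B: "\<And>i j. i < n \<Longrightarrow> j < m \<Longrightarrow> i \<notin> J \<Longrightarrow> fst (snd x) $$ (i, j) = 0"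
    and k: "k < n" "k \<notin> J"
  shows "f x = 0"
proof -
  define v where "v t i = (if i \<in> J then 1 else inverse t)" for t :: 'k and i
  define w where "w t i = (if i \<in> J then 1 else t)" for t :: 'k and i
  define y where "y t =
    (mat n n (\<lambda>(i, j). (if i \<in> J \<and> j \<notin> J then t else 1) * fst x $$ (i, j)), fst (snd x),
     mat p n (\<lambda>(i, j). fst (snd (snd x)) $$ (i, j) * w t j), snd (snd (snd x)))" for t
  note cx = lds_space_carrier[OF x]
  have w_reg: "(\<lambda>t. w t i) \<in> regular_line" for i
    unfolding w_def by (cases "i \<in> J") (simp_all add: regular_fun_const regular_line_id)
  show ?thesis
  proof (rule semi_invariant_vanishes_in_limit[OF f])
    show "(\<lambda>t. c (y t)) \<in> regular_line" if "c \<in> lds_coords n m p" for c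
    proof (rule regular_fun_lds_coords[OF _ _ _ _ that])
      show "regular_mat UNIV {\<lambda>t. t} (\<lambda>_. 1) n n (\<lambda>t. fst (y t))"
        unfolding y_def
        by (rule regular_matI)
          (auto intro!: regular_fun_mult regular_fun_const regular_line_if)
      show "regular_mat UNIV {\<lambda>t. t} (\<lambda>_. 1) p n (\<lambda>t. fst (snd (snd (y t))))"
        unfolding y_def
        by (rule regular_matI) (auto intro!: regular_fun_mult regular_fun_const w_reg)
    qed (use cx in \<open>auto simp: y_def intro!: regular_mat_const\<close>)
    show "(\<lambda>t. det (mat_diag n (w t)) ^ N) \<in> regular_line"
      by (intro regular_fun_power regular_fun_det_mat_diag poly_fun_const w_reg)
  next
    show "det (mat_diag n (w 0)) ^ N = 0"
      using det_mat_diag_eq_0[of k n "w 0"] k N by (simp add: w_def)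
  next
    fix t :: 'k assume t: "t \<noteq> 0"
    have vw: "v t i * w t i = 1" for i using t by (simp add: v_def w_def)
    note inv = det_mat_diag_inverse[of "v t" "w t", OF vw]
    have "lds_act n m p (mat_diag n (v t)) x = y t"
      unfolding lds_act_inverse_pair[OF mat_diag_dim mat_diag_dim inv(1) x] y_def prod.inject
    proof (intro conjI refl)
      show "mat_diag n (v t) * fst x * mat_diag n (w t)
          = mat n n (\<lambda>(i, j). (if i \<in> J \<and> j \<notin> J then t else 1) * fst x $$ (i, j))"
        using A t by (subst mat_diag_mult_left[OF cx(1)], subst mat_diag_mult_right)
          (auto simp: v_def w_def)
      show "mat_diag n (v t) * fst (snd x) = fst (snd x)"
        using B cx(2) by (subst mat_diag_mult_left[OF cx(2)]) (auto simp: v_def)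
      show "fst (snd (snd x)) * mat_diag n (w t)
          = mat p n (\<lambda>(i, j). fst (snd (snd x)) $$ (i, j) * w t j)"
        by (rule mat_diag_mult_right[OF cx(3)])
    qed
    then have "f (y t) = det (mat_diag n (v t)) ^ N * f x"
      using semi[OF GL_inverse_pair(1)[OF mat_diag_dim mat_diag_dim inv(1)] x] by simp
    moreover have "det (mat_diag n (w t)) ^ N * det (mat_diag n (v t)) ^ N = 1"
      using inv(2) by (metis mult.commute power_mult_distrib power_one)
    ultimately show "det (mat_diag n (w t)) ^ N * f (y t) = f x"
      by (simp only: mult.assoc[symmetric] mult_1_left)
  qed
qed

text \<open>
  Here \<open>J\<close> indexes a coordinate subspace that is invariant and killed by \<open>C\<close>.  The one-parameter
  group of the previous lemma is multiplied by the scalar \<open>t\<close>, which leaves its effect on \<open>A\<close>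
  unchanged and moves the possible pole from \<open>B\<close> to the vanishing columns of \<open>C\<close>.
\<close>

lemma semi_invariant_vanishes_unobservable_block:
  fixes x :: "'k :: field_char_0 lds"
  assumes f: "f \<in> poly_fun (lds_coords n m p)"
    and semi: "\<And>g x. g \<in> carrier (GL n) \<Longrightarrow> x \<in> lds_space n m p \<Longrightarrow>
      det g ^ N * f (lds_act n m p g x) = f x"
    and N: "N \<ge> 1" and x: "x \<in> lds_space n m p"
    and A: "\<And>i j. i < n \<Longrightarrow> j < n \<Longrightarrow> i \<notin> J \<Longrightarrow> j \<in> J \<Longrightarrow> fst x $$ (i, j) = 0"
    and C: "\<And>i j. i < p \<Longrightarrow> j < n \<Longrightarrow> j \<in> J \<Longrightarrow> fst (snd (snd x)) $$ (i, j) = 0"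
    and k: "k < n" "k \<in> J"
  shows "f x = 0"
proof -
  define v where "v t i = (if i \<in> J then t else 1)" for t :: 'k and i
  define w where "w t i = (if i \<in> J then inverse t else 1)" for t :: 'k and i
  define y where "y t =
    (mat n n (\<lambda>(i, j). (if i \<in> J \<and> j \<notin> J then t else 1) * fst x $$ (i, j)),
     mat n m (\<lambda>(i, j). v t i * fst (snd x) $$ (i, j)),
     fst (snd (snd x)), snd (snd (snd x)))" for t
  note cx = lds_space_carrier[OF x]
  have v_reg: "(\<lambda>t. v t i) \<in> regular_line" for i
    unfolding v_def by (rule regular_line_if)
  show ?thesis
  proof (rule semi_invariant_vanishes_in_limit[OF f])
    show "(\<lambda>t. c (y t)) \<in> regular_line" if "c \<in> lds_coords n m p" for c
    proof (rule regular_fun_lds_coords[OF _ _ _ _ that])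
      show "regular_mat UNIV {\<lambda>t. t} (\<lambda>_. 1) n n (\<lambda>t. fst (y t))"
        unfolding y_def
        by (rule regular_matI)
          (auto intro!: regular_fun_mult regular_fun_const regular_line_if)
      show "regular_mat UNIV {\<lambda>t. t} (\<lambda>_. 1) n m (\<lambda>t. fst (snd (y t)))"
        unfolding y_def
        by (rule regular_matI) (auto intro!: regular_fun_mult regular_fun_const v_reg)
    qed (use cx in \<open>auto simp: y_def intro!: regular_mat_const\<close>)
    show "(\<lambda>t. det (mat_diag n (v t)) ^ N) \<in> regular_line"
      by (intro regular_fun_power regular_fun_det_mat_diag poly_fun_const v_reg)
  next
    show "det (mat_diag n (v 0)) ^ N = 0"
      using det_mat_diag_eq_0[of k n "v 0"] k N by (simp add: v_def)
  next
    fix t :: 'k assume t: "t \<noteq> 0"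
    have vw: "v t i * w t i = 1" for i using t by (simp add: v_def w_def)
    note inv = det_mat_diag_inverse[of "v t" "w t", OF vw]
    have "lds_act n m p (mat_diag n (v t)) x = y t"
      unfolding lds_act_inverse_pair[OF mat_diag_dim mat_diag_dim inv(1) x] y_def prod.inject
    proof (intro conjI refl)
      show "mat_diag n (v t) * fst x * mat_diag n (w t)
          = mat n n (\<lambda>(i, j). (if i \<in> J \<and> j \<notin> J then t else 1) * fst x $$ (i, j))"
        using A t by (subst mat_diag_mult_left[OF cx(1)], subst mat_diag_mult_right)
          (auto simp: v_def w_def)
      show "mat_diag n (v t) * fst (snd x) = mat n m (\<lambda>(i, j). v t i * fst (snd x) $$ (i, j))"
        by (rule mat_diag_mult_left[OF cx(2)])
      show "fst (snd (snd x)) * mat_diag n (w t) = fst (snd (snd x))"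
        using C cx(3) by (subst mat_diag_mult_right[OF cx(3)]) (auto simp: w_def)
    qed
    then show "det (mat_diag n (v t)) ^ N * f (y t) = f x"
      using semi[OF GL_inverse_pair(1)[OF mat_diag_dim mat_diag_dim inv(1)] x] by simp
  qed
qed

text \<open>
  The exchange lemma for \<open>F = U\<close>, transposed.  The conclusion makes the columns of \<open>S\<close> with index
  in \<open>J\<close> a basis of \<open>U\<close>, with the rows of \<open>T\<close> as coordinate functionals.
\<close>

lemma adapted_basis:
  fixes U :: "'k :: field vec set"
  assumes U: "is_subspace n U"
  obtains S T J where "S \<in> carrier_mat n n" "T \<in> carrier_mat n n" "T * S = 1\<^sub>m n" "S * T = 1\<^sub>m n"
    "\<And>j. j < n \<Longrightarrow> j \<in> J \<Longrightarrow> col S j \<in> U" "\<And>u i. u \<in> U \<Longrightarrow> i < n \<Longrightarrow> i \<notin> J \<Longrightarrow> row T i \<bullet> u = 0"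
proof -
  have UC: "U \<subseteq> carrier_vec n" using is_subspaceD(1)[OF U] by auto
  obtain M N where M: "M \<in> carrier_mat n n" and N: "N \<in> carrier_mat n n"
    and MN: "M * N = 1\<^sub>m n" and NM: "N * M = 1\<^sub>m n"
    and ex: "\<And>i. i < n \<Longrightarrow> row M i \<in> U \<or> (\<forall>v\<in>U. v \<bullet> col N i = 0)"
    using exchange_basis[OF UC] by metis
  show thesis
  proof (rule that[of "M\<^sup>T" "N\<^sup>T" "{i. row M i \<in> U}"])
    show "N\<^sup>T * M\<^sup>T = 1\<^sub>m n" using transpose_mult[OF M N] MN by simp
    show "M\<^sup>T * N\<^sup>T = 1\<^sub>m n" using transpose_mult[OF N M] NM by simp
    show "row N\<^sup>T i \<bullet> u = 0" if "u \<in> U" "i < n" "i \<notin> {i. row M i \<in> U}" for u i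
    proof -
      have "u \<in> carrier_vec n" "col N i \<in> carrier_vec n" using that(1) UC N by auto
      then have "col N i \<bullet> u = u \<bullet> col N i" by (rule comm_scalar_prod[rotated])
      then show ?thesis using ex[OF that(2)] that N by simp
    qed
  qed (use M N in auto)
qed

text \<open>
  A violating subspace becomes a coordinate subspace after moving \<open>x\<close> within its orbit, which
  multiplies \<open>f x\<close> by a nonzero factor only.
\<close>

lemma controllable_if_semi_invariant:
  fixes x :: "'k :: field_char_0 lds"
  assumes f: "f \<in> poly_fun (lds_coords n m p)"
    and semi: "\<And>g x. g \<in> carrier (GL n) \<Longrightarrow> x \<in> lds_space n m p \<Longrightarrow>
      f (lds_act n m p g x) = det g ^ N * f x"
    and N: "N \<ge> 1" and x: "x \<in> lds_space n m p" and fx: "f x \<noteq> 0"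
  shows "controllable n m (fst x) (fst (snd x))"
  unfolding controllable_def
proof (intro allI impI)
  fix U assume U: "is_subspace n U" and AU: "\<forall>u\<in>U. fst x *\<^sub>v u \<in> U"
    and BU: "\<forall>w\<in>carrier_vec m. fst (snd x) *\<^sub>v w \<in> U"
  note cx = lds_space_carrier[OF x]
  obtain S T J where S: "S \<in> carrier_mat n n" and T: "T \<in> carrier_mat n n"
    and TS: "T * S = 1\<^sub>m n" and ST: "S * T = 1\<^sub>m n"
    and cols: "\<And>j. j < n \<Longrightarrow> j \<in> J \<Longrightarrow> col S j \<in> U"
    and rows: "\<And>u i. u \<in> U \<Longrightarrow> i < n \<Longrightarrow> i \<notin> J \<Longrightarrow> row T i \<bullet> u = 0"
    using adapted_basis[OF U] by metis
  let ?x = "lds_act n m p T x"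
  have TG: "T \<in> carrier (GL n)" by (rule GL_inverse_pair(1)[OF T S TS])
  have eq: "?x = (T * fst x * S, T * fst (snd x), fst (snd (snd x)) * S, snd (snd (snd x)))"
    by (rule lds_act_inverse_pair[OF T S TS x])
  have "f ?x \<noteq> 0" using semi[OF TG x] fx TG by (simp add: GL_carrier_det)
  have all: "k \<in> J" if k: "k < n" for k
  proof (rule ccontr)
    assume kJ: "k \<notin> J"
    have "f ?x = 0"
    proof (rule semi_invariant_vanishes_reachable_block[OF f semi N _ _ _ k kJ])
      show "?x \<in> lds_space n m p" using lds_act_closed[OF TG x] .
    next
      fix i j assume ij: "i < n" "j < n" "i \<notin> J" "j \<in> J"
      have "fst ?x = T * (fst x * S)" unfolding eq by (simp add: assoc_mult_mat[OF T cx(1) S])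
      also have "(T * (fst x * S)) $$ (i, j) = row T i \<bullet> col (fst x * S) j"
        using ij S T by (intro index_mult_mat(1)) simp_all
      also have "col (fst x * S) j = fst x *\<^sub>v col S j" by (rule col_mult2[OF cx(1) S ij(2)])
      also have "row T i \<bullet> (fst x *\<^sub>v col S j) = 0" using rows cols AU ij by simp
      finally show "fst ?x $$ (i, j) = 0" .
    next
      fix i j assume ij: "i < n" "j < m" "i \<notin> J"
      have "col (fst (snd x)) j = fst (snd x) *\<^sub>v unit_vec m j"
        using cx(2) ij(2) by (intro eq_vecI) auto
      then have "col (fst (snd x)) j \<in> U" using BU by simp
      then show "fst (snd ?x) $$ (i, j) = 0"
        using rows ij T cx(2) unfolding eq by simp
    qed
    with \<open>f ?x \<noteq> 0\<close> show False by simp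
  qed
  show "U = carrier_vec n"
  proof (intro equalityI subsetI)
    fix u :: "'k vec" assume u: "u \<in> carrier_vec n"
    have "S *\<^sub>v (T *\<^sub>v u) \<in> U"
      by (rule mult_mat_vec_in_subspace[OF U S]) (use cols all T u in auto)
    moreover have "S *\<^sub>v (T *\<^sub>v u) = u"
      using assoc_mult_mat_vec[OF S T u] ST u by simp
    ultimately show "u \<in> U" by simp
  qed (rule is_subspaceD(1)[OF U])
qed

lemma observable_if_semi_invariant:
  fixes x :: "'k :: field_char_0 lds"
  assumes f: "f \<in> poly_fun (lds_coords n m p)"
    and semi: "\<And>g x. g \<in> carrier (GL n) \<Longrightarrow> x \<in> lds_space n m p \<Longrightarrow>
      det g ^ N * f (lds_act n m p g x) = f x"
    and N: "N \<ge> 1" and x: "x \<in> lds_space n m p" and fx: "f x \<noteq> 0"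
  shows "observable n p (fst x) (fst (snd (snd x)))"
  unfolding observable_def
proof (intro allI impI)
  fix U assume U: "is_subspace n U" and AU: "\<forall>u\<in>U. fst x *\<^sub>v u \<in> U"
    and CU: "\<forall>u\<in>U. fst (snd (snd x)) *\<^sub>v u = 0\<^sub>v p"
  note cx = lds_space_carrier[OF x]
  obtain S T J where S: "S \<in> carrier_mat n n" and T: "T \<in> carrier_mat n n"
    and TS: "T * S = 1\<^sub>m n" and ST: "S * T = 1\<^sub>m n"
    and cols: "\<And>j. j < n \<Longrightarrow> j \<in> J \<Longrightarrow> col S j \<in> U"
    and rows: "\<And>u i. u \<in> U \<Longrightarrow> i < n \<Longrightarrow> i \<notin> J \<Longrightarrow> row T i \<bullet> u = 0"
    using adapted_basis[OF U] by metis
  let ?x = "lds_act n m p T x"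
  have TG: "T \<in> carrier (GL n)" by (rule GL_inverse_pair(1)[OF T S TS])
  have eq: "?x = (T * fst x * S, T * fst (snd x), fst (snd (snd x)) * S, snd (snd (snd x)))"
    by (rule lds_act_inverse_pair[OF T S TS x])
  have "f ?x \<noteq> 0" using semi[OF TG x] fx by auto
  have nJ: "k \<notin> J" if k: "k < n" for k
  proof
    assume kJ: "k \<in> J"
    have "f ?x = 0"
    proof (rule semi_invariant_vanishes_unobservable_block[OF f semi N _ _ _ k kJ])
      show "?x \<in> lds_space n m p" using lds_act_closed[OF TG x] .
    next
      fix i j assume ij: "i < n" "j < n" "i \<notin> J" "j \<in> J"
      have "fst ?x = T * (fst x * S)" unfolding eq by (simp add: assoc_mult_mat[OF T cx(1) S])
      also have "(T * (fst x * S)) $$ (i, j) = row T i \<bullet> col (fst x * S) j"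
        using ij S T by (intro index_mult_mat(1)) simp_all
      also have "col (fst x * S) j = fst x *\<^sub>v col S j" by (rule col_mult2[OF cx(1) S ij(2)])
      also have "row T i \<bullet> (fst x *\<^sub>v col S j) = 0" using rows cols AU ij by simp
      finally show "fst ?x $$ (i, j) = 0" .
    next
      fix i j assume ij: "i < p" "j < n" "j \<in> J"
      have "fst (snd (snd ?x)) $$ (i, j) = (fst (snd (snd x)) *\<^sub>v col S j) $ i"
        using ij S cx(3) unfolding eq by simp
      also have "\<dots> = 0" using CU cols ij by simp
      finally show "fst (snd (snd ?x)) $$ (i, j) = 0" .
    qed
    with \<open>f ?x \<noteq> 0\<close> show False by simp
  qed
  show "U = {0\<^sub>v n}"
  proof (intro equalityI subsetI)
    fix u assume u: "u \<in> U"
    then have uc: "u \<in> carrier_vec n" by (rule is_subspaceD(1)[OF U])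
    have "T *\<^sub>v u = 0\<^sub>v n" using rows[OF u] nJ T by (intro eq_vecI) auto
    then have "S *\<^sub>v (T *\<^sub>v u) = 0\<^sub>v n" using S by (intro eq_vecI) auto
    then show "u \<in> {0\<^sub>v n}" using assoc_mult_mat_vec[OF S T uc] ST uc by simp
  qed (use is_subspaceD(2)[OF U] in simp)
qed


section \<open>Minors of the controllability and observability matrices\<close>

text \<open>
  The selection \<open>s k = (i, j)\<close> stands for column \<open>j\<close> of \<open>A^i B\<close>, respectively row \<open>j\<close> of \<open>C A^i\<close>.
  All exponents \<open>i\<close> are admitted, so that the span of the columns is visibly \<open>A\<close>-invariant.
\<close>

definition controllability_minor :: "nat \<Rightarrow> (nat \<Rightarrow> nat \<times> nat) \<Rightarrow> 'k :: field lds \<Rightarrow> 'k mat" where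
  "controllability_minor n s x =
     mat n n (\<lambda>(l, k). (fst x ^\<^sub>m fst (s k) * fst (snd x)) $$ (l, snd (s k)))"

definition observability_minor :: "nat \<Rightarrow> (nat \<Rightarrow> nat \<times> nat) \<Rightarrow> 'k :: field lds \<Rightarrow> 'k mat" where
  "observability_minor n s x =
     mat n n (\<lambda>(k, l). (fst (snd (snd x)) * fst x ^\<^sub>m fst (s k)) $$ (snd (s k), l))"

lemma pow_mat_conj:
  fixes g h A :: "'k :: field mat"
  assumes g: "g \<in> carrier_mat n n" and h: "h \<in> carrier_mat n n" and A: "A \<in> carrier_mat n n"
    and gh: "g * h = 1\<^sub>m n"
  shows "(g * A * h) ^\<^sub>m i = g * A ^\<^sub>m i * h"
proof (induction i)
  case 0
  show ?case using g h A gh by simp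
next
  case (Suc i)
  have hg: "h * g = 1\<^sub>m n" by (rule mat_mult_left_right_inverse[OF g h gh])
  have P: "A ^\<^sub>m i \<in> carrier_mat n n" using A by simp
  have gP: "g * A ^\<^sub>m i \<in> carrier_mat n n" using g P by (rule mult_carrier_mat)
  have Ah: "A * h \<in> carrier_mat n n" using A h by (rule mult_carrier_mat)
  have gAh: "g * (A * h) \<in> carrier_mat n n" using g Ah by (rule mult_carrier_mat)
  have "(g * A * h) ^\<^sub>m Suc i = g * A ^\<^sub>m i * h * (g * (A * h))"
    using Suc by (simp add: assoc_mult_mat[OF g A h])
  also have "\<dots> = g * A ^\<^sub>m i * (h * (g * (A * h)))"
    by (rule assoc_mult_mat[OF gP h gAh])
  also have "h * (g * (A * h)) = h * g * (A * h)"
    by (rule assoc_mult_mat[OF h g Ah, symmetric])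
  also have "\<dots> = A * h" by (simp only: hg left_mult_one_mat[OF Ah])
  also have "g * A ^\<^sub>m i * (A * h) = g * A ^\<^sub>m i * A * h"
    by (rule assoc_mult_mat[OF gP A h, symmetric])
  also have "\<dots> = g * A ^\<^sub>m Suc i * h"
    by (simp add: assoc_mult_mat[OF g P A])
  finally show ?case .
qed

lemma regular_mat_controllability_minor:
  assumes s: "\<And>k. k < n \<Longrightarrow> snd (s k) < m" and f: "f \<in> poly_fun (lds_coords n m p)"
  shows "regular_mat (lds_space n m p) (lds_coords n m p) f n n (controllability_minor n s)"
proof (rule regular_matI)
  fix i j assume ij: "i < n" "j < n"
  have "regular_mat (lds_space n m p) (lds_coords n m p) f n m (\<lambda>x. fst x ^\<^sub>m fst (s j) * fst (snd x))"
    by (rule regular_mat_mult[OF f]) (rule regular_mat_pow[OF f] regular_mat_lds)+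
  from regular_mat_entry[OF this ij(1) s[OF ij(2)]]
  show "(\<lambda>x. controllability_minor n s x $$ (i, j)) \<in> regular_fun (lds_space n m p) (lds_coords n m p) f"
    using ij by (simp add: controllability_minor_def)
qed (simp add: controllability_minor_def)

lemma regular_mat_observability_minor:
  assumes s: "\<And>k. k < n \<Longrightarrow> snd (s k) < p" and f: "f \<in> poly_fun (lds_coords n m p)"
  shows "regular_mat (lds_space n m p) (lds_coords n m p) f n n (observability_minor n s)"
proof (rule regular_matI)
  fix i j assume ij: "i < n" "j < n"
  have "regular_mat (lds_space n m p) (lds_coords n m p) f p n
      (\<lambda>x. fst (snd (snd x)) * fst x ^\<^sub>m fst (s i))"
    by (rule regular_mat_mult[OF f]) (rule regular_mat_pow[OF f] regular_mat_lds)+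
  from regular_mat_entry[OF this s[OF ij(1)] ij(2)]
  show "(\<lambda>x. observability_minor n s x $$ (i, j)) \<in> regular_fun (lds_space n m p) (lds_coords n m p) f"
    using ij by (simp add: observability_minor_def)
qed (simp add: observability_minor_def)

lemma controllability_minor_act:
  assumes s: "\<And>k. k < n \<Longrightarrow> snd (s k) < m"
    and g: "g \<in> carrier (GL n)" and x: "x \<in> lds_space n m p"
  shows "controllability_minor n s (lds_act n m p g x) = g * controllability_minor n s x"
proof (rule eq_matI)
  note cx = lds_space_carrier[OF x] and cg = GL_inverse(1,2)[OF g] and gi = GL_inverse(5)[OF g]
  let ?h = "inv\<^bsub>GL n\<^esub> g"
  fix l k assume "l < dim_row (g * controllability_minor n s x)" "k < dim_col (g * controllability_minor n s x)"
  then have lk: "l < n" "k < n" using cg by (simp_all add: controllability_minor_def)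
  let ?P = "fst x ^\<^sub>m fst (s k)"
  have P: "?P \<in> carrier_mat n n" using cx by simp
  have "(g * fst x * ?h) ^\<^sub>m fst (s k) * (g * fst (snd x)) = g * ?P * ?h * (g * fst (snd x))"
    by (simp only: pow_mat_conj[OF cg cx(1) gi])
  also have "\<dots> = g * ?P * (?h * (g * fst (snd x)))"
    by (rule assoc_mult_mat[of _ n n _ n _ m]) (use P cg cx in simp_all)
  also have "?h * (g * fst (snd x)) = ?h * g * fst (snd x)"
    by (rule assoc_mult_mat[symmetric, of _ n n _ n _ m]) (use cg cx in simp_all)
  also have "\<dots> = fst (snd x)" using GL_inverse(4)[OF g] cx by simp
  also have "g * ?P * fst (snd x) = g * (?P * fst (snd x))"
    by (rule assoc_mult_mat[of _ n n _ n _ m]) (use P cg cx in simp_all)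
  finally have "(g * fst x * ?h) ^\<^sub>m fst (s k) * (g * fst (snd x)) = g * (?P * fst (snd x))" .
  then have "controllability_minor n s (lds_act n m p g x) $$ (l, k)
      = (g * (?P * fst (snd x))) $$ (l, snd (s k))"
    using lk by (simp add: controllability_minor_def lds_act_inverse_pair[OF cg gi x])
  also have "\<dots> = (g * controllability_minor n s x) $$ (l, k)"
    using lk s[OF lk(2)] cg cx P
    by (auto simp: controllability_minor_def scalar_prod_def intro!: sum.cong)
  finally show "controllability_minor n s (lds_act n m p g x) $$ (l, k)
      = (g * controllability_minor n s x) $$ (l, k)" .
qed (use GL_inverse(1)[OF g] in \<open>simp_all add: controllability_minor_def\<close>)

lemma observability_minor_act:
  assumes s: "\<And>k. k < n \<Longrightarrow> snd (s k) < p"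
    and g: "g \<in> carrier (GL n)" and x: "x \<in> lds_space n m p"
  shows "observability_minor n s (lds_act n m p g x) = observability_minor n s x * inv\<^bsub>GL n\<^esub> g"
proof (rule eq_matI)
  note cx = lds_space_carrier[OF x] and cg = GL_inverse(1,2)[OF g] and gi = GL_inverse(5)[OF g]
  let ?h = "inv\<^bsub>GL n\<^esub> g"
  fix k l assume "k < dim_row (observability_minor n s x * ?h)" "l < dim_col (observability_minor n s x * ?h)"
  then have lk: "l < n" "k < n" using cg by (simp_all add: observability_minor_def)
  let ?P = "fst x ^\<^sub>m fst (s k)" and ?C = "fst (snd (snd x))"
  have P: "?P \<in> carrier_mat n n" using cx by simp
  have Ph: "?P * ?h \<in> carrier_mat n n" using P cg(2) by (rule mult_carrier_mat)
  have gPh: "g * (?P * ?h) \<in> carrier_mat n n" using cg(1) Ph by (rule mult_carrier_mat)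
  have "?C * ?h * (g * fst x * ?h) ^\<^sub>m fst (s k) = ?C * ?h * (g * ?P * ?h)"
    by (simp only: pow_mat_conj[OF cg cx(1) gi])
  also have "g * ?P * ?h = g * (?P * ?h)"
    by (rule assoc_mult_mat[OF cg(1) P cg(2)])
  also have "?C * ?h * (g * (?P * ?h)) = ?C * (?h * (g * (?P * ?h)))"
    by (rule assoc_mult_mat[OF cx(3) cg(2) gPh])
  also have "?h * (g * (?P * ?h)) = ?h * g * (?P * ?h)"
    by (rule assoc_mult_mat[OF cg(2) cg(1) Ph, symmetric])
  also have "\<dots> = ?P * ?h" by (simp only: GL_inverse(4)[OF g] left_mult_one_mat[OF Ph])
  also have "?C * (?P * ?h) = ?C * ?P * ?h"
    by (rule assoc_mult_mat[OF cx(3) P cg(2), symmetric])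
  finally have "?C * ?h * (g * fst x * ?h) ^\<^sub>m fst (s k) = ?C * ?P * ?h" .
  then have "observability_minor n s (lds_act n m p g x) $$ (k, l) = (?C * ?P * ?h) $$ (snd (s k), l)"
    using lk by (simp add: observability_minor_def lds_act_inverse_pair[OF cg gi x])
  also have "\<dots> = (observability_minor n s x * ?h) $$ (k, l)"
    using lk s[OF lk(2)] cg cx P
    by (auto simp: observability_minor_def scalar_prod_def intro!: sum.cong)
  finally show "observability_minor n s (lds_act n m p g x) $$ (k, l)
      = (observability_minor n s x * ?h) $$ (k, l)" .
qed (use GL_inverse(2)[OF g] in \<open>simp_all add: observability_minor_def\<close>)

text \<open>
  By the exchange lemma \<open>n\<close> of the columns can be selected unless a nonzero \<open>w\<close> annihilates all of
  them.  Such a \<open>w\<close> gives the proper subspace of all \<open>v\<close> with \<open>w \<bullet> A^i v = 0\<close> for every \<open>i\<close>, which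
  is invariant and contains the image of \<open>B\<close>.
\<close>

lemma controllability_minor_nonzero:
  fixes x :: "'k :: field lds"
  assumes ctr: "controllable n m (fst x) (fst (snd x))" and x: "x \<in> lds_space n m p"
  obtains s where "\<And>k. k < n \<Longrightarrow> snd (s k) < m" "det (controllability_minor n s x) \<noteq> 0"
proof -
  note cx = lds_space_carrier[OF x]
  let ?A = "fst x" and ?B = "fst (snd x)"
  define F where "F = {col (?A ^\<^sub>m i * ?B) j | i j. j < m}"
  have P: "?A ^\<^sub>m i \<in> carrier_mat n n" for i using cx by simp
  have PB: "?A ^\<^sub>m i * ?B \<in> carrier_mat n m" for i using P cx(2) by (rule mult_carrier_mat)
  have FC: "F \<subseteq> carrier_vec n"
  proof
    fix v assume "v \<in> F"
    then obtain i j where "v = col (?A ^\<^sub>m i * ?B) j" unfolding F_def by auto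
    then show "v \<in> carrier_vec n" using carrier_matD(1)[OF PB] by (simp add: carrier_vecI)
  qed
  obtain M N where M: "M \<in> carrier_mat n n" and N: "N \<in> carrier_mat n n"
    and MN: "M * N = 1\<^sub>m n" and NM: "N * M = 1\<^sub>m n"
    and ex: "\<And>i. i < n \<Longrightarrow> row M i \<in> F \<or> (\<forall>v\<in>F. v \<bullet> col N i = 0)"
    using exchange_basis[OF FC] by metis
  have "\<exists>i j. row M k = col (?A ^\<^sub>m i * ?B) j \<and> j < m" if k: "k < n" for k
  proof (rule ccontr)
    let ?w = "col N k"
    have w: "?w \<in> carrier_vec n" using N by (simp add: carrier_vecI)
    assume "\<not> ?thesis"
    then have "row M k \<notin> F" unfolding F_def by blast
    then have orth: "col (?A ^\<^sub>m i * ?B) j \<bullet> ?w = 0" if "j < m" for i j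
      using ex[OF k] that unfolding F_def by blast
    \<comment> \<open>The row \<open>row M k\<close> witnesses that \<open>U\<close> is proper, as it pairs to \<open>1\<close> with \<open>w\<close>.\<close>
    define U where "U = {v \<in> carrier_vec n. \<forall>i. ?w \<bullet> (?A ^\<^sub>m i *\<^sub>v v) = 0}"
    have Pv: "?A ^\<^sub>m i *\<^sub>v v \<in> carrier_vec n" if "v \<in> carrier_vec n" for i v
      using P that by (rule mult_mat_vec_carrier)
    have "is_subspace n U"
      unfolding is_subspace_iff
    proof (intro conjI ballI allI subsetI)
      show "v \<in> carrier_vec n" if "v \<in> U" for v using that by (simp add: U_def)
      have "?A ^\<^sub>m i *\<^sub>v 0\<^sub>v n = 0\<^sub>v n" for i
        using cx(1) by (intro eq_vecI) (auto simp: scalar_prod_def)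
      then show "0\<^sub>v n \<in> U" using w by (simp add: U_def)
    next
      fix u v assume "u \<in> U" "v \<in> U"
      then show "u + v \<in> U"
        using w by (simp add: U_def mult_add_distrib_mat_vec[OF P] scalar_prod_add_distrib[OF w Pv Pv])
    next
      fix c :: 'k and u assume "u \<in> U"
      then show "c \<cdot>\<^sub>v u \<in> U"
        using w by (simp add: U_def mult_mat_vec[OF P] scalar_prod_smult_distrib[OF w Pv])
    qed
    moreover have "?A *\<^sub>v u \<in> U" if u: "u \<in> U" for u
    proof -
      have uc: "u \<in> carrier_vec n" using u by (simp add: U_def)
      have "?A ^\<^sub>m i *\<^sub>v (?A *\<^sub>v u) = ?A ^\<^sub>m Suc i *\<^sub>v u" for i
        using assoc_mult_mat_vec[OF P cx(1) uc] by simp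
      then have "?w \<bullet> (?A ^\<^sub>m i *\<^sub>v (?A *\<^sub>v u)) = 0" for i
        using u unfolding U_def by (metis (mono_tags, lifting) mem_Collect_eq)
      then show ?thesis using mult_mat_vec_carrier[OF cx(1) uc] by (simp add: U_def)
    qed
    moreover have "?B *\<^sub>v u \<in> U" if u: "u \<in> carrier_vec m" for u
    proof -
      have "?w \<bullet> (?A ^\<^sub>m i *\<^sub>v (?B *\<^sub>v u)) = 0" for i
      proof -
        have "?A ^\<^sub>m i *\<^sub>v (?B *\<^sub>v u) = (?A ^\<^sub>m i * ?B) *\<^sub>v u"
          using assoc_mult_mat_vec[OF P cx(2) u] by simp
        then have "?w \<bullet> (?A ^\<^sub>m i *\<^sub>v (?B *\<^sub>v u)) = ((?A ^\<^sub>m i * ?B)\<^sup>T *\<^sub>v ?w) \<bullet> u"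
          using transpose_vec_mult_scalar[OF PB u w] by simp
        also have "(?A ^\<^sub>m i * ?B)\<^sup>T *\<^sub>v ?w = 0\<^sub>v m"
          using orth carrier_matD[OF PB] by (intro eq_vecI) auto
        finally show ?thesis using u by simp
      qed
      then show ?thesis using mult_mat_vec_carrier[OF cx(2) u] by (simp add: U_def)
    qed
    ultimately have "U = carrier_vec n" using ctr unfolding controllable_def by blast
    moreover have Mk: "row M k \<in> carrier_vec n" using M by (simp add: carrier_vecI)
    ultimately have "?w \<bullet> (?A ^\<^sub>m 0 *\<^sub>v row M k) = 0" unfolding U_def by blast
    then have "row M k \<bullet> ?w = 0"
      using cx(1) Mk comm_scalar_prod[OF Mk w] by simp
    moreover have "row M k \<bullet> ?w = 1" using arg_cong[OF MN, of "\<lambda>Z. Z $$ (k, k)"] k M N by simp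
    ultimately show False by simp
  qed
  then obtain a b where ab: "\<And>k. k < n \<Longrightarrow> row M k = col (?A ^\<^sub>m a k * ?B) (b k) \<and> b k < m"
    by metis
  show thesis
  proof (rule that)
    show "snd (a k, b k) < m" if "k < n" for k using ab[OF that] by simp
    have "controllability_minor n (\<lambda>k. (a k, b k)) x = M\<^sup>T"
    proof (rule eq_matI)
      fix l k assume "l < dim_row M\<^sup>T" "k < dim_col M\<^sup>T"
      then have lk: "l < n" "k < n" using M by simp_all
      have "M $$ (k, l) = row M k $ l" using lk M by simp
      also have "\<dots> = (?A ^\<^sub>m a k * ?B) $$ (l, b k)"
        using ab[OF lk(2)] lk carrier_matD[OF PB[of "a k"]] by simp
      finally show "controllability_minor n (\<lambda>k. (a k, b k)) x $$ (l, k) = M\<^sup>T $$ (l, k)"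
        using lk M by (simp add: controllability_minor_def)
    qed (use M in \<open>simp_all add: controllability_minor_def\<close>)
    moreover have "det M * det N = 1" using det_mult[OF M N] MN by simp
    ultimately show "det (controllability_minor n (\<lambda>k. (a k, b k)) x) \<noteq> 0"
      using det_transpose[OF M] by auto
  qed
qed

text \<open>
  Dually, a nonzero \<open>w\<close> annihilated by all rows of the matrices \<open>C A^i\<close> lies in the unobservable
  subspace, the intersection of the kernels of the \<open>C A^i\<close>.
\<close>

lemma observability_minor_nonzero:
  fixes x :: "'k :: field lds"
  assumes obs: "observable n p (fst x) (fst (snd (snd x)))" and x: "x \<in> lds_space n m p"
  obtains s where "\<And>k. k < n \<Longrightarrow> snd (s k) < p" "det (observability_minor n s x) \<noteq> 0"
proof -
  note cx = lds_space_carrier[OF x]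
  let ?A = "fst x" and ?C = "fst (snd (snd x))"
  define F where "F = {row (?C * ?A ^\<^sub>m i) j | i j. j < p}"
  have P: "?A ^\<^sub>m i \<in> carrier_mat n n" for i using cx by simp
  have CP: "?C * ?A ^\<^sub>m i \<in> carrier_mat p n" for i using cx(3) P by (rule mult_carrier_mat)
  have FC: "F \<subseteq> carrier_vec n"
  proof
    fix v assume "v \<in> F"
    then obtain i j where "v = row (?C * ?A ^\<^sub>m i) j" unfolding F_def by auto
    then show "v \<in> carrier_vec n" using carrier_matD(2)[OF CP] by (simp add: carrier_vecI)
  qed
  obtain M N where M: "M \<in> carrier_mat n n" and N: "N \<in> carrier_mat n n"
    and MN: "M * N = 1\<^sub>m n" and NM: "N * M = 1\<^sub>m n"
    and ex: "\<And>i. i < n \<Longrightarrow> row M i \<in> F \<or> (\<forall>v\<in>F. v \<bullet> col N i = 0)"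
    using exchange_basis[OF FC] by metis
  have "\<exists>i j. row M k = row (?C * ?A ^\<^sub>m i) j \<and> j < p" if k: "k < n" for k
  proof (rule ccontr)
    let ?w = "col N k"
    have w: "?w \<in> carrier_vec n" using N by (simp add: carrier_vecI)
    assume "\<not> ?thesis"
    then have "row M k \<notin> F" unfolding F_def by blast
    then have orth: "row (?C * ?A ^\<^sub>m i) j \<bullet> ?w = 0" if "j < p" for i j
      using ex[OF k] that unfolding F_def by blast
    define U where "U = {v \<in> carrier_vec n. \<forall>i. (?C * ?A ^\<^sub>m i) *\<^sub>v v = 0\<^sub>v p}"
    have "is_subspace n U"
      unfolding is_subspace_iff
    proof (intro conjI ballI allI subsetI)
      show "v \<in> carrier_vec n" if "v \<in> U" for v using that by (simp add: U_def)
      have "(?C * ?A ^\<^sub>m i) *\<^sub>v 0\<^sub>v n = 0\<^sub>v p" for i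
        using carrier_matD[OF CP] by (intro eq_vecI) (auto simp: scalar_prod_def)
      then show "0\<^sub>v n \<in> U" by (simp add: U_def)
    next
      fix u v assume "u \<in> U" "v \<in> U"
      then show "u + v \<in> U" by (simp add: U_def mult_add_distrib_mat_vec[OF CP])
    next
      fix c :: 'k and u assume "u \<in> U"
      moreover have "c \<cdot>\<^sub>v 0\<^sub>v p = 0\<^sub>v p" by (intro eq_vecI) auto
      ultimately show "c \<cdot>\<^sub>v u \<in> U" by (simp add: U_def mult_mat_vec[OF CP])
    qed
    moreover have "?A *\<^sub>v u \<in> U" if u: "u \<in> U" for u
    proof -
      have uc: "u \<in> carrier_vec n" using u by (simp add: U_def)
      have "(?C * ?A ^\<^sub>m i) *\<^sub>v (?A *\<^sub>v u) = (?C * ?A ^\<^sub>m Suc i) *\<^sub>v u" for i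
        using assoc_mult_mat_vec[OF CP cx(1) uc] assoc_mult_mat[OF cx(3) P cx(1)] by simp
      then have "(?C * ?A ^\<^sub>m i) *\<^sub>v (?A *\<^sub>v u) = 0\<^sub>v p" for i
        using u unfolding U_def by (metis (mono_tags, lifting) mem_Collect_eq)
      then show ?thesis using mult_mat_vec_carrier[OF cx(1) uc] by (simp add: U_def)
    qed
    moreover have "?C *\<^sub>v u = 0\<^sub>v p" if u: "u \<in> U" for u
    proof -
      have "(?C * ?A ^\<^sub>m 0) *\<^sub>v u = 0\<^sub>v p" using u unfolding U_def by blast
      then show ?thesis using cx by simp
    qed
    ultimately have "U = {0\<^sub>v n}" using obs unfolding observable_def by blast
    moreover have "?w \<in> U"
      unfolding U_def using w orth carrier_matD[OF CP] by (auto intro!: eq_vecI)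
    ultimately have "?w = 0\<^sub>v n" by blast
    moreover have "row M k \<bullet> ?w = 1" using arg_cong[OF MN, of "\<lambda>Z. Z $$ (k, k)"] k M N by simp
    moreover have "row M k \<in> carrier_vec n" using M by (simp add: carrier_vecI)
    ultimately show False by simp
  qed
  then obtain a b where ab: "\<And>k. k < n \<Longrightarrow> row M k = row (?C * ?A ^\<^sub>m a k) (b k) \<and> b k < p"
    by metis
  show thesis
  proof (rule that)
    show "snd (a k, b k) < p" if "k < n" for k using ab[OF that] by simp
    have "observability_minor n (\<lambda>k. (a k, b k)) x = M"
    proof (rule eq_matI)
      fix k l assume "k < dim_row M" "l < dim_col M"
      then have lk: "l < n" "k < n" using M by simp_all
      have "M $$ (k, l) = row M k $ l" using lk M by simp
      also have "\<dots> = (?C * ?A ^\<^sub>m a k) $$ (b k, l)"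
        using ab[OF lk(2)] lk carrier_matD[OF CP[of "a k"]] by simp
      finally show "observability_minor n (\<lambda>k. (a k, b k)) x $$ (k, l) = M $$ (k, l)"
        using lk by (simp add: observability_minor_def)
    qed (use M in \<open>simp_all add: observability_minor_def\<close>)
    moreover have "det M * det N = 1" using det_mult[OF M N] MN by simp
    ultimately show "det (observability_minor n (\<lambda>k. (a k, b k)) x) \<noteq> 0" by auto
  qed
qed

lemma regular_fun_one_polynomial:
  assumes "h \<in> regular_fun E X (\<lambda>_. 1)"
  shows "\<exists>q \<in> poly_fun X. \<forall>x\<in>E. q x = h x"
  using assms unfolding regular_fun_def by auto

lemma chi_stable_1_iff_controllable:
  fixes \<Sigma> :: "'k :: field_char_0 lds"
  assumes \<Sigma>: "\<Sigma> \<in> lds_space n m p"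
  shows "chi_stable n m p 1 \<Sigma> \<longleftrightarrow> controllable n m (fst \<Sigma>) (fst (snd \<Sigma>))"
proof
  assume "chi_stable n m p 1 \<Sigma>"
  then obtain N f where N: "N \<ge> 1" and f: "f \<in> poly_fun (lds_coords n m p)" "f \<Sigma> \<noteq> 0"
    and semi: "\<And>g x. g \<in> carrier (GL n) \<Longrightarrow> x \<in> lds_space n m p \<Longrightarrow>
      f (lds_act n m p g x) = det g powi (int N * 1) * f x"
    unfolding chi_stable_def by blast
  show "controllable n m (fst \<Sigma>) (fst (snd \<Sigma>))"
    by (rule controllable_if_semi_invariant[OF f(1) _ N \<Sigma> f(2)]) (simp add: semi)
next
  assume "controllable n m (fst \<Sigma>) (fst (snd \<Sigma>))"
  from controllability_minor_nonzero[OF this \<Sigma>] obtain s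
    where s: "\<And>k. k < n \<Longrightarrow> snd (s k) < m" and nz: "det (controllability_minor n s \<Sigma>) \<noteq> 0"
    by metis
  let ?R = "controllability_minor n s :: 'k lds \<Rightarrow> 'k mat"
  have det_reg: "(\<lambda>x. det (?R x)) \<in> regular_fun (lds_space n m p) (lds_coords n m p) (\<lambda>_. 1)"
    by (rule regular_fun_det[OF poly_fun_const], rule regular_mat_controllability_minor[OF s poly_fun_const])
  obtain f where f: "f \<in> poly_fun (lds_coords n m p)"
    and fR: "\<And>x. x \<in> lds_space n m p \<Longrightarrow> f x = det (?R x)"
    using regular_fun_one_polynomial[OF det_reg] by metis
  have R: "regular_mat (lds_space n m p) (lds_coords n m p) f n n ?R"
    by (rule regular_mat_controllability_minor[OF s f])
  have c: "?R x \<in> carrier_mat n n" for x by (simp add: controllability_minor_def)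
  show "chi_stable n m p 1 \<Sigma>"
  proof (rule chi_stable_if_slice[OF \<Sigma> f _ _ R])
    show "f \<Sigma> \<noteq> 0" using nz fR[OF \<Sigma>] by simp
    show "f (lds_act n m p g x) = det g powi 1 * f x"
      if "g \<in> carrier (GL n)" "x \<in> lds_space n m p" for g x
      using fR[OF that(2)] fR[OF lds_act_closed[OF that]] controllability_minor_act[OF s that]
        det_mult[OF GL_inverse(1)[OF that(1)] c] by simp
    show "regular_mat (lds_space n m p) (lds_coords n m p) f n n (\<lambda>x. cramer_inverse (?R x))"
      by (rule regular_mat_cramer_inverse[OF f R]) (simp add: fR)
    show "?R x * cramer_inverse (?R x) = 1\<^sub>m n" if "x \<in> lds_space n m p" "f x \<noteq> 0" for x
      using that fR by (intro cramer_inverse(2) c) simp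
    show "?R (lds_act n m p g x) = g * ?R x"
      if "g \<in> carrier (GL n)" "x \<in> lds_space n m p" "f x \<noteq> 0" for g x
      by (rule controllability_minor_act[OF s that(1,2)])
  qed
qed

text \<open>
  The observability minor transforms by \<open>g^{-1}\<close> on the right, so its inverse is the equivariant map
  to the group, and its determinant has weight \<open>-1\<close>.
\<close>

lemma chi_stable_minus_1_iff_observable:
  fixes \<Sigma> :: "'k :: field_char_0 lds"
  assumes \<Sigma>: "\<Sigma> \<in> lds_space n m p"
  shows "chi_stable n m p (- 1) \<Sigma> \<longleftrightarrow> observable n p (fst \<Sigma>) (fst (snd (snd \<Sigma>)))"
proof
  assume "chi_stable n m p (- 1) \<Sigma>"
  then obtain N f where N: "N \<ge> 1" and f: "f \<in> poly_fun (lds_coords n m p)" "f \<Sigma> \<noteq> 0"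
    and semi: "\<And>g x. g \<in> carrier (GL n) \<Longrightarrow> x \<in> lds_space n m p \<Longrightarrow>
      f (lds_act n m p g x) = det g powi (int N * (- 1)) * f x"
    unfolding chi_stable_def by blast
  show "observable n p (fst \<Sigma>) (fst (snd (snd \<Sigma>)))"
  proof (rule observable_if_semi_invariant[OF f(1) _ N \<Sigma> f(2)])
    fix g :: "'k mat" and x :: "'k lds"
    assume "g \<in> carrier (GL n)" "x \<in> lds_space n m p"
    then show "det g ^ N * f (lds_act n m p g x) = f x"
      using semi by (simp add: power_int_minus GL_carrier_det)
  qed
next
  assume "observable n p (fst \<Sigma>) (fst (snd (snd \<Sigma>)))"
  from observability_minor_nonzero[OF this \<Sigma>] obtain s
    where s: "\<And>k. k < n \<Longrightarrow> snd (s k) < p" and nz: "det (observability_minor n s \<Sigma>) \<noteq> 0"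
    by metis
  let ?O = "observability_minor n s :: 'k lds \<Rightarrow> 'k mat"
  have det_reg: "(\<lambda>x. det (?O x)) \<in> regular_fun (lds_space n m p) (lds_coords n m p) (\<lambda>_. 1)"
    by (rule regular_fun_det[OF poly_fun_const], rule regular_mat_observability_minor[OF s poly_fun_const])
  obtain f where f: "f \<in> poly_fun (lds_coords n m p)"
    and fO: "\<And>x. x \<in> lds_space n m p \<Longrightarrow> f x = det (?O x)"
    using regular_fun_one_polynomial[OF det_reg] by metis
  have O: "regular_mat (lds_space n m p) (lds_coords n m p) f n n ?O"
    by (rule regular_mat_observability_minor[OF s f])
  have c: "?O x \<in> carrier_mat n n" for x by (simp add: observability_minor_def)
  have det_inv: "det g * det (inv\<^bsub>GL n\<^esub> g) = 1" if "g \<in> carrier (GL n)" for g :: "'k mat"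
    using det_mult[OF GL_inverse(1,2)[OF that]] GL_inverse(5)[OF that] by simp
  show "chi_stable n m p (- 1) \<Sigma>"
  proof (rule chi_stable_if_slice[OF \<Sigma> f _ _ _ O])
    show "f \<Sigma> \<noteq> 0" using nz fO[OF \<Sigma>] by simp
    show "f (lds_act n m p g x) = det g powi (- 1) * f x"
      if "g \<in> carrier (GL n)" "x \<in> lds_space n m p" for g :: "'k mat" and x :: "'k lds"
    proof -
      have "det (inv\<^bsub>GL n\<^esub> g) = inverse (det g)"
        using det_inv[OF that(1)] by (metis inverse_unique)
      then show ?thesis
        using fO[OF that(2)] fO[OF lds_act_closed[OF that]] observability_minor_act[OF s that]
          det_mult[OF c GL_inverse(2)[OF that(1)]] by (simp add: power_int_minus)
    qed
    show "regular_mat (lds_space n m p) (lds_coords n m p) f n n (\<lambda>x. cramer_inverse (?O x))"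
      by (rule regular_mat_cramer_inverse[OF f O]) (simp add: fO)
    show "cramer_inverse (?O x) * ?O x = 1\<^sub>m n" if "x \<in> lds_space n m p" "f x \<noteq> 0" for x
      using that fO by (intro cramer_inverse(3) c) simp
    show "cramer_inverse (?O (lds_act n m p g x)) = g * cramer_inverse (?O x)"
      if "g \<in> carrier (GL n)" "x \<in> lds_space n m p" "f x \<noteq> 0" for g x
    proof -
      let ?h = "inv\<^bsub>GL n\<^esub> g" and ?Q = "cramer_inverse (?O x)" and ?y = "lds_act n m p g x"
      let ?S = "cramer_inverse (?O ?y)"
      note cg = GL_inverse(1,2)[OF that(1)]
      have dx: "det (?O x) \<noteq> 0" using fO[OF that(2)] that(3) by simp
      have act: "?O ?y = ?O x * ?h" by (rule observability_minor_act[OF s that(1,2)])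
      have "det (?O ?y) \<noteq> 0"
        using dx det_inv[OF that(1)] det_mult[OF c cg(2)] unfolding act by auto
      note y = cramer_inverse[OF c this] and q = cramer_inverse[OF c dx]
      have gQ: "g * ?Q \<in> carrier_mat n n" using cg(1) q(1) by (rule mult_carrier_mat)
      have "?O ?y * (g * ?Q) = ?O x * (?h * (g * ?Q))"
        unfolding act by (rule assoc_mult_mat[OF c cg(2) gQ])
      also have "?h * (g * ?Q) = ?h * g * ?Q"
        by (rule assoc_mult_mat[OF cg(2,1) q(1), symmetric])
      also have "\<dots> = ?Q" using GL_inverse(4)[OF that(1)] q(1) by simp
      finally have "?O ?y * (g * ?Q) = 1\<^sub>m n" using q(2) by simp
      then have "?S = ?S * (?O ?y * (g * ?Q))" using y(1) by simp
      also have "\<dots> = ?S * ?O ?y * (g * ?Q)"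
        by (rule assoc_mult_mat[OF y(1) c gQ, symmetric])
      also have "\<dots> = g * ?Q" by (simp only: y(3) left_mult_one_mat[OF gQ])
      finally show ?thesis .
    qed
  qed
qed


section \<open>Dimensions of subspaces\<close>

text \<open>
  Kill the basis vectors outside \<open>J\<close> in a basis adapted to \<open>U\<close>.  The projection exhibits \<open>U\<close> as a
  linear image of the whole space, hence as finite-dimensional, and rank-nullity
  for \<open>1 - P\<close> will compare \<open>U\<close> with larger subspaces.
\<close>

lemma subspace_projection:
  fixes U :: "'k :: field vec set"
  assumes U: "is_subspace n U"
  obtains P where "P \<in> carrier_mat n n" "\<And>v. v \<in> carrier_vec n \<Longrightarrow> P *\<^sub>v v \<in> U"
    "\<And>u. u \<in> U \<Longrightarrow> P *\<^sub>v u = u"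
proof -
  obtain S T J where S: "S \<in> carrier_mat n n" and T: "T \<in> carrier_mat n n"
    and TS: "T * S = 1\<^sub>m n" and ST: "S * T = 1\<^sub>m n"
    and cols: "\<And>j. j < n \<Longrightarrow> j \<in> J \<Longrightarrow> col S j \<in> U"
    and rows: "\<And>u i. u \<in> U \<Longrightarrow> i < n \<Longrightarrow> i \<notin> J \<Longrightarrow> row T i \<bullet> u = 0"
    using adapted_basis[OF U] by metis
  define S' where "S' = mat n n (\<lambda>(i, j). if j \<in> J then S $$ (i, j) else 0)"
  have S': "S' \<in> carrier_mat n n" by (simp add: S'_def)
  show thesis
  proof (rule that[of "S' * T"])
    show "S' * T \<in> carrier_mat n n" using S' T by (rule mult_carrier_mat)
    have colS': "col S' j \<in> U" if "j < n" for j
    proof (cases "j \<in> J")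
      case True
      have "col S' j = col S j" using that True S by (intro eq_vecI) (auto simp: S'_def)
      then show ?thesis using cols that True by simp
    next
      case False
      have "col S' j = 0\<^sub>v n" using that False by (intro eq_vecI) (auto simp: S'_def)
      then show ?thesis using is_subspaceD(2)[OF U] by simp
    qed
    show "S' * T *\<^sub>v v \<in> U" if v: "v \<in> carrier_vec n" for v
      using mult_mat_vec_in_subspace[OF U S' colS' mult_mat_vec_carrier[OF T v]]
      by (simp add: assoc_mult_mat_vec[OF S' T v])
    show "S' * T *\<^sub>v u = u" if u: "u \<in> U" for u
    proof -
      have uc: "u \<in> carrier_vec n" using is_subspaceD(1)[OF U u] .
      note Tu = mult_mat_vec_carrier[OF T uc]
      have zero: "(T *\<^sub>v u) $ j = 0" if "j < n" "j \<notin> J" for j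
        using rows[OF u that] T that by simp
      have "S' *\<^sub>v (T *\<^sub>v u) = S *\<^sub>v (T *\<^sub>v u)"
      proof (rule eq_vecI)
        fix i assume "i < dim_vec (S *\<^sub>v (T *\<^sub>v u))"
        then have i: "i < n" using S by simp
        have "row S' i \<bullet> (T *\<^sub>v u) = row S i \<bullet> (T *\<^sub>v u)"
          unfolding scalar_prod_def using i S S' Tu T zero
          by (intro sum.cong) (auto simp: S'_def simp del: index_mult_mat_vec)
        then show "(S' *\<^sub>v (T *\<^sub>v u)) $ i = (S *\<^sub>v (T *\<^sub>v u)) $ i" using i S S' by simp
      qed (use S S' in simp)
      also have "\<dots> = u" using assoc_mult_mat_vec[OF S T uc] ST uc by simp
      finally show ?thesis by (simp add: assoc_mult_mat_vec[OF S' T uc])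
    qed
  qed
qed

lemma vectorspace_subspace:
  fixes U :: "'k :: field vec set"
  assumes "is_subspace d U"
  shows "vectorspace class_ring (module_vec TYPE('k) d\<lparr>carrier := U\<rparr>)"
  using vectorspace.subspace_is_vs[OF vec_vs] assms unfolding is_subspace_def by blast

lemma linear_map_subspace:
  fixes U W :: "'k :: field vec set"
  assumes U: "is_subspace d U" and W: "is_subspace e W"
    and "\<And>u. u \<in> U \<Longrightarrow> T u \<in> W"
    and "\<And>u v. u \<in> U \<Longrightarrow> v \<in> U \<Longrightarrow> T (u + v) = T u + T v"
    and "\<And>c u. u \<in> U \<Longrightarrow> T (c \<cdot>\<^sub>v u) = c \<cdot>\<^sub>v T u"
  shows "linear_map class_ring (module_vec TYPE('k) d\<lparr>carrier := U\<rparr>)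
    (module_vec TYPE('k) e\<lparr>carrier := W\<rparr>) T"
proof -
  note U' = vectorspace_subspace[OF U] and W' = vectorspace_subspace[OF W]
  have hom: "T \<in> LinearCombinations.module_hom class_ring (module_vec TYPE('k) d\<lparr>carrier := U\<rparr>)
      (module_vec TYPE('k) e\<lparr>carrier := W\<rparr>)"
    unfolding LinearCombinations.module_hom_def mem_Collect_eq using assms(3-5) by (simp add: module_vec_simps)
  show ?thesis
    by (rule linear_map.intro[OF U' W' mod_hom.intro[OF vectorspace.axioms(1)[OF U']
            vectorspace.axioms(1)[OF W'] mod_hom_axioms.intro[OF hom]]])
qed

lemma is_subspace_carrier: "is_subspace d (carrier_vec d :: 'k :: field vec set)"
  unfolding is_subspace_iff by auto

lemma fin_dim_subspace:
  fixes U :: "'k :: field vec set"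
  assumes U: "is_subspace d U"
  shows "vectorspace.fin_dim class_ring (module_vec TYPE('k) d\<lparr>carrier := U\<rparr>)"
proof -
  obtain P where P: "P \<in> carrier_mat d d" and PU: "\<And>v. v \<in> carrier_vec d \<Longrightarrow> P *\<^sub>v v \<in> U"
    and id: "\<And>u. u \<in> U \<Longrightarrow> P *\<^sub>v u = u"
    using subspace_projection[OF U] by metis
  have lin: "linear_map class_ring (module_vec TYPE('k) d\<lparr>carrier := carrier_vec d\<rparr>)
      (module_vec TYPE('k) d\<lparr>carrier := U\<rparr>) (\<lambda>v. P *\<^sub>v v)"
    by (rule linear_map_subspace[OF is_subspace_carrier U])
      (use P PU in \<open>auto simp: mult_add_distrib_mat_vec[OF P] mult_mat_vec[OF P]\<close>)
  have self: "module_vec TYPE('k) d\<lparr>carrier := carrier_vec d\<rparr> = module_vec TYPE('k) d"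
    by (simp add: module_vec_def)
  have "(\<lambda>v. P *\<^sub>v v) ` carrier_vec d = U"
  proof (intro equalityI subsetI)
    fix u assume u: "u \<in> U"
    show "u \<in> (\<lambda>v. P *\<^sub>v v) ` carrier_vec d"
      by (rule image_eqI[of _ _ u]) (use id[OF u] is_subspaceD(1)[OF U u] in simp_all)
  qed (use PU in auto)
  moreover have "vectorspace.fin_dim class_ring (module_vec TYPE('k) d)"
    by (rule vec_space.fin_dim)
  ultimately show ?thesis
    using linear_map.rank_nullity_main(2)[OF lin] by (simp add: self module_vec_simps)
qed

lemma linear_zero:
  fixes T :: "'k :: field vec \<Rightarrow> 'k vec"
  assumes "T (0\<^sub>v d) \<in> carrier_vec e" and "\<And>c. T (c \<cdot>\<^sub>v 0\<^sub>v d) = c \<cdot>\<^sub>v T (0\<^sub>v d)"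
  shows "T (0\<^sub>v d) = 0\<^sub>v e"
proof -
  have "0 \<cdot>\<^sub>v 0\<^sub>v d = (0\<^sub>v d :: 'k vec)" by (intro eq_vecI) auto
  then have "T (0\<^sub>v d) = 0 \<cdot>\<^sub>v T (0\<^sub>v d)" using assms(2)[of 0] by simp
  also have "\<dots> = 0\<^sub>v e" using assms(1) by (intro eq_vecI) auto
  finally show ?thesis .
qed

lemma is_subspace_image:
  assumes U: "is_subspace d U"
    and T: "\<And>u. u \<in> U \<Longrightarrow> T u \<in> carrier_vec e"
    and add: "\<And>u v. u \<in> U \<Longrightarrow> v \<in> U \<Longrightarrow> T (u + v) = T u + T v"
    and smult: "\<And>c u. u \<in> U \<Longrightarrow> T (c \<cdot>\<^sub>v u) = c \<cdot>\<^sub>v T u"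
  shows "is_subspace e (T ` U :: 'k :: field vec set)"
proof -
  note D = is_subspaceD[OF U]
  have "T (0\<^sub>v d) = 0\<^sub>v e" using T[OF D(2)] smult[OF D(2)] by (rule linear_zero)
  then have "0\<^sub>v e \<in> T ` U" using D(2) by (metis imageI)
  then show ?thesis unfolding is_subspace_iff
    using T D(3,4) by (auto simp flip: add smult)
qed

lemma sdim_rank_nullity:
  fixes U :: "'k :: field vec set"
  assumes U: "is_subspace d U"
    and T: "\<And>u. u \<in> U \<Longrightarrow> T u \<in> carrier_vec e"
    and add: "\<And>u v. u \<in> U \<Longrightarrow> v \<in> U \<Longrightarrow> T (u + v) = T u + T v"
    and smult: "\<And>c u. u \<in> U \<Longrightarrow> T (c \<cdot>\<^sub>v u) = c \<cdot>\<^sub>v T u"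
  shows "sdim e (T ` U) + sdim d {u \<in> U. T u = 0\<^sub>v e} = sdim d U"
proof -
  interpret linear_map class_ring "module_vec TYPE('k) d\<lparr>carrier := U\<rparr>"
      "module_vec TYPE('k) e\<lparr>carrier := carrier_vec e\<rparr>" T
    by (rule linear_map_subspace[OF U is_subspace_carrier T add smult])
  have "imT = T ` U" "kerT = {u \<in> U. T u = 0\<^sub>v e}"
    by (simp_all add: im_def ker_def module_vec_simps)
  then show ?thesis
    using rank_nullity[OF fin_dim_subspace[OF U]] by (simp add: sdim_def)
qed

text \<open>Rank-nullity for the identity of \<open>{0}\<close>, which is its own image and kernel.\<close>

lemma sdim_zero: "sdim d {0\<^sub>v d :: 'k :: field vec} = 0"
proof -
  have "is_subspace d {0\<^sub>v d :: 'k vec}" unfolding is_subspace_iff by (auto intro!: eq_vecI)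
  from sdim_rank_nullity[OF this, of "\<lambda>u. u" d]
  have "sdim d {0\<^sub>v d :: 'k vec} + sdim d {u \<in> {0\<^sub>v d :: 'k vec}. u = 0\<^sub>v d} = sdim d {0\<^sub>v d :: 'k vec}"
    by simp
  moreover have "{u \<in> {0\<^sub>v d :: 'k vec}. u = 0\<^sub>v d} = {0\<^sub>v d}" by auto
  ultimately show ?thesis by simp
qed

lemma sdim_eq_0:
  fixes U :: "'k :: field vec set"
  assumes U: "is_subspace d U" and z: "sdim d U = 0"
  shows "U = {0\<^sub>v d}"
proof -
  interpret vectorspace class_ring "module_vec TYPE('k) d\<lparr>carrier := U\<rparr>"
    by (rule vectorspace_subspace[OF U])
  obtain b where b: "finite b" "basis b"
    using finite_basis_exists[OF fin_dim_subspace[OF U]] by metis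
  then have "card b = 0" using dim_basis[OF b] z by (simp add: sdim_def)
  then have "b = {}" using b(1) by simp
  then have "span {} = U" using b(2) unfolding basis_def by simp
  then show ?thesis using span_empty by (simp add: module_vec_simps)
qed

lemma sdim_inj_image:
  fixes U :: "'k :: field vec set"
  assumes U: "is_subspace d U"
    and T: "\<And>u. u \<in> U \<Longrightarrow> T u \<in> carrier_vec e"
    and add: "\<And>u v. u \<in> U \<Longrightarrow> v \<in> U \<Longrightarrow> T (u + v) = T u + T v"
    and smult: "\<And>c u. u \<in> U \<Longrightarrow> T (c \<cdot>\<^sub>v u) = c \<cdot>\<^sub>v T u"
    and inj: "\<And>u. u \<in> U \<Longrightarrow> T u = 0\<^sub>v e \<Longrightarrow> u = 0\<^sub>v d"
  shows "sdim e (T ` U) = sdim d U"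
proof -
  note D = is_subspaceD[OF U]
  have "T (0\<^sub>v d) = 0\<^sub>v e" using T[OF D(2)] smult[OF D(2)] by (rule linear_zero)
  have "{u \<in> U. T u = 0\<^sub>v e} = {0\<^sub>v d}"
  proof (intro equalityI subsetI)
    fix u assume "u \<in> {u \<in> U. T u = 0\<^sub>v e}"
    then show "u \<in> {0\<^sub>v d}" using inj[of u] by simp
  next
    fix u assume "u \<in> {0\<^sub>v d :: 'k vec}"
    then show "u \<in> {u \<in> U. T u = 0\<^sub>v e}" using D(2) \<open>T (0\<^sub>v d) = 0\<^sub>v e\<close> by simp
  qed
  then show ?thesis using sdim_rank_nullity[OF U T add smult] by (simp add: sdim_zero)
qed

text \<open>
  Rank-nullity for \<open>1 - P\<close> on \<open>V\<close>, where \<open>P\<close> projects onto \<open>U\<close>: the kernel is \<open>U\<close>, so the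
  dimensions differ by that of the image.
\<close>

lemma sdim_mono_eq:
  fixes U V :: "'k :: field vec set"
  assumes U: "is_subspace d U" and V: "is_subspace d V" and sub: "U \<subseteq> V"
  shows "sdim d U \<le> sdim d V" "sdim d U = sdim d V \<Longrightarrow> U = V"
proof -
  obtain P where P: "P \<in> carrier_mat d d" and PU: "\<And>v. v \<in> carrier_vec d \<Longrightarrow> P *\<^sub>v v \<in> U"
    and id: "\<And>u. u \<in> U \<Longrightarrow> P *\<^sub>v u = u"
    using subspace_projection[OF U] by metis
  let ?T = "\<lambda>v. v - P *\<^sub>v v"
  note c = is_subspaceD(1)[OF V] and Pc = mult_mat_vec_carrier[OF P is_subspaceD(1)[OF V]]
  have T: "?T v \<in> carrier_vec d" if "v \<in> V" for v using c[OF that] Pc[OF that] by simp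
  have add: "?T (u + v) = ?T u + ?T v" if "u \<in> V" "v \<in> V" for u v
    using carrier_vecD[OF c[OF that(1)]] carrier_vecD[OF c[OF that(2)]] carrier_matD[OF P]
    by (intro eq_vecI) (auto simp: mult_add_distrib_mat_vec[OF P c[OF that(1)] c[OF that(2)]]
        simp del: index_mult_mat_vec)
  have smult: "?T (a \<cdot>\<^sub>v u) = a \<cdot>\<^sub>v ?T u" if "u \<in> V" for a u
    using carrier_vecD[OF c[OF that]] carrier_matD[OF P]
    by (intro eq_vecI) (auto simp: mult_mat_vec[OF P c[OF that]] right_diff_distrib simp del: index_mult_mat_vec)
  have zero: "v = P *\<^sub>v v" if "v \<in> V" "?T v = 0\<^sub>v d" for v
  proof (rule eq_vecI)
    fix i assume "i < dim_vec (P *\<^sub>v v)"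
    then have "i < d" using P by simp
    then have "?T v $ i = 0" using that(2) by simp
    then show "v $ i = (P *\<^sub>v v) $ i" using \<open>i < d\<close> P by (simp del: index_mult_mat_vec)
  qed (use P c[OF that(1)] in simp)
  have "{v \<in> V. ?T v = 0\<^sub>v d} = U"
  proof (intro equalityI subsetI)
    fix v assume "v \<in> {v \<in> V. ?T v = 0\<^sub>v d}"
    then have v: "v \<in> V" "v = P *\<^sub>v v" using zero by auto
    then show "v \<in> U" using PU[OF c[OF v(1)]] by simp
  next
    fix u assume u: "u \<in> U"
    then show "u \<in> {v \<in> V. ?T v = 0\<^sub>v d}"
      using sub id[OF u] is_subspaceD(1)[OF U u] by auto
  qed
  then have rn: "sdim d (?T ` V) + sdim d U = sdim d V"
    using sdim_rank_nullity[OF V T add smult] by simp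
  then show "sdim d U \<le> sdim d V" by simp
  show "U = V" if "sdim d U = sdim d V"
  proof -
    have image: "is_subspace d (?T ` V)" by (rule is_subspace_image[OF V T add smult])
    have "sdim d (?T ` V) = 0" using rn that by simp
    then have "?T ` V = {0\<^sub>v d}" by (rule sdim_eq_0[OF image])
    then have "?T v = 0\<^sub>v d" if "v \<in> V" for v using that by blast
    then have "V \<subseteq> U" using \<open>{v \<in> V. ?T v = 0\<^sub>v d} = U\<close> by blast
    then show ?thesis using sub by blast
  qed
qed

lemma sdim_carrier: "sdim d (carrier_vec d :: 'k :: field vec set) = d"
proof -
  have "module_vec TYPE('k) d\<lparr>carrier := carrier_vec d\<rparr> = module_vec TYPE('k) d"
    by (simp add: module_vec_def)
  then show ?thesis by (simp add: sdim_def vec_space.dim_is_n)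
qed

text \<open>The product of \<open>U\<close> with \<open>k^p\<close>, inside the space of vectors of length \<open>n + p\<close>.\<close>

definition cylinder :: "nat \<Rightarrow> nat \<Rightarrow> 'k :: field vec set \<Rightarrow> 'k vec set" where
  "cylinder n p U = {v \<in> carrier_vec (n + p). vec_first v n \<in> U}"

lemma vec_first_linear:
  fixes u v :: "'k :: field vec"
  shows "u \<in> carrier_vec (n + p) \<Longrightarrow> v \<in> carrier_vec (n + p) \<Longrightarrow>
      vec_first (u + v) n = vec_first u n + vec_first v n"
    "u \<in> carrier_vec (n + p) \<Longrightarrow> vec_first (c \<cdot>\<^sub>v u) n = c \<cdot>\<^sub>v vec_first u n"
    "u \<in> carrier_vec (n + p) \<Longrightarrow> v \<in> carrier_vec (n + p) \<Longrightarrow>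
      vec_last (u + v) p = vec_last u p + vec_last v p"
    "u \<in> carrier_vec (n + p) \<Longrightarrow> vec_last (c \<cdot>\<^sub>v u) p = c \<cdot>\<^sub>v vec_last u p"
  by (auto simp: vec_first_def vec_last_def intro!: eq_vecI)

lemma vec_first_append: "u \<in> carrier_vec n \<Longrightarrow> vec_first (u @\<^sub>v w) n = u"
  by (auto simp: vec_first_def intro!: eq_vecI)

lemma vec_last_append: "w \<in> carrier_vec p \<Longrightarrow> vec_last (u @\<^sub>v w) p = w"
  by (auto simp: vec_last_def intro!: eq_vecI)

lemma is_subspace_cylinder:
  fixes U :: "'k :: field vec set"
  assumes "is_subspace n U"
  shows "is_subspace (n + p) (cylinder n p U)"
proof -
  have "vec_first (0\<^sub>v (n + p)) n = (0\<^sub>v n :: 'k vec)" by (auto simp: vec_first_def intro!: eq_vecI)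
  then show ?thesis
    using assms unfolding is_subspace_iff cylinder_def by (auto simp: vec_first_linear)
qed

text \<open>
  Rank-nullity for \<open>vec_first\<close>, whose kernel \<open>0 \<times> k^p\<close> is mapped isomorphically to \<open>k^p\<close> by
  \<open>vec_last\<close>.
\<close>

lemma sdim_cylinder:
  fixes U :: "'k :: field vec set"
  assumes U: "is_subspace n U"
  shows "sdim (n + p) (cylinder n p U) = sdim n U + p"
proof -
  let ?Z = "cylinder n p {0\<^sub>v n :: 'k vec}"
  have Z: "is_subspace (n + p) ?Z"
    by (rule is_subspace_cylinder) (auto simp: is_subspace_iff intro!: eq_vecI)
  have "sdim p ((\<lambda>v. vec_last v p) ` ?Z) = sdim (n + p) ?Z"
  proof (rule sdim_inj_image[OF Z])
    fix u assume u: "u \<in> ?Z" "vec_last u p = 0\<^sub>v p"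
    then have "u = 0\<^sub>v n @\<^sub>v 0\<^sub>v p" using vec_first_last_append[of u n p] by (simp add: cylinder_def)
    then show "u = 0\<^sub>v (n + p)" by auto
  qed (auto simp: cylinder_def vec_first_linear)
  moreover have "(\<lambda>v. vec_last v p) ` ?Z = carrier_vec p"
  proof (intro equalityI subsetI)
    fix w :: "'k vec" assume w: "w \<in> carrier_vec p"
    have "0\<^sub>v n @\<^sub>v w \<in> ?Z" using w by (simp add: cylinder_def vec_first_append)
    then show "w \<in> (\<lambda>v. vec_last v p) ` ?Z"
      using vec_last_append[OF w, of "0\<^sub>v n"] by (metis image_eqI)
  qed auto
  ultimately have dimZ: "sdim (n + p) ?Z = p" using sdim_carrier by metis
  have "sdim n ((\<lambda>v. vec_first v n) ` cylinder n p U)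
      + sdim (n + p) {v \<in> cylinder n p U. vec_first v n = 0\<^sub>v n} = sdim (n + p) (cylinder n p U)"
    by (rule sdim_rank_nullity[OF is_subspace_cylinder[OF U]])
      (auto simp: cylinder_def vec_first_linear)
  moreover have "(\<lambda>v. vec_first v n) ` cylinder n p U = U"
  proof (intro equalityI subsetI)
    fix u assume u: "u \<in> U"
    note uc = is_subspaceD(1)[OF U u]
    have "u @\<^sub>v 0\<^sub>v p \<in> cylinder n p U" using u uc by (simp add: cylinder_def vec_first_append)
    then show "u \<in> (\<lambda>v. vec_first v n) ` cylinder n p U"
      using vec_first_append[OF uc, of "0\<^sub>v p"] by (metis image_eqI)
  qed (auto simp: cylinder_def)
  moreover have "{v \<in> cylinder n p U. vec_first v n = 0\<^sub>v n} = ?Z"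
    using is_subspaceD(2)[OF U] by (auto simp: cylinder_def)
  ultimately show ?thesis using dimZ by simp
qed

lemma sdim_pad_zero:
  fixes U :: "'k :: field vec set"
  assumes U: "is_subspace n U"
  shows "is_subspace (n + p) ((\<lambda>u. u @\<^sub>v 0\<^sub>v p) ` U)"
    "sdim (n + p) ((\<lambda>u. u @\<^sub>v 0\<^sub>v p) ` U) = sdim n U"
proof -
  note c = is_subspaceD(1)[OF U]
  have T: "u @\<^sub>v 0\<^sub>v p \<in> carrier_vec (n + p)" if "u \<in> U" for u
    using c[OF that] by simp
  have add: "(u + v) @\<^sub>v 0\<^sub>v p = (u @\<^sub>v 0\<^sub>v p) + (v @\<^sub>v 0\<^sub>v p)" if "u \<in> U" "v \<in> U" for u v
    using c[OF that(1)] c[OF that(2)] by (intro eq_vecI) auto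
  have smult: "(a \<cdot>\<^sub>v u) @\<^sub>v 0\<^sub>v p = a \<cdot>\<^sub>v (u @\<^sub>v 0\<^sub>v p)" if "u \<in> U" for a u
    using c[OF that] by (intro eq_vecI) auto
  show "is_subspace (n + p) ((\<lambda>u. u @\<^sub>v 0\<^sub>v p) ` U)"
    by (rule is_subspace_image[OF U T add smult])
  show "sdim (n + p) ((\<lambda>u. u @\<^sub>v 0\<^sub>v p) ` U) = sdim n U"
  proof (rule sdim_inj_image[OF U T add smult])
    fix u assume u: "u \<in> U" "u @\<^sub>v 0\<^sub>v p = 0\<^sub>v (n + p)"
    have "vec_first (u @\<^sub>v 0\<^sub>v p) n = vec_first (0\<^sub>v (n + p)) n" using u(2) by simp
    then show "u = 0\<^sub>v n" using vec_first_append[OF c[OF u(1)]]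
      by (auto simp: vec_first_def intro!: eq_vecI)
  qed
qed


section \<open>Slopes of the associated Lomadze system\<close>

text \<open>
  The conventions \<open>0 / 0 = 0\<close> and \<open>a / 0 = \<infinity>\<close> hold for extended reals; the extra clauses in
  the second and fourth equivalence account for \<open>0 / 0\<close>.
\<close>

lemma ennreal_slope:
  fixes a b :: nat
  shows "(1 :: ennreal) < of_nat a / of_nat b \<longleftrightarrow> b < a"
    "(1 :: ennreal) \<le> of_nat a / of_nat b \<longleftrightarrow> b \<le> a \<and> 0 < a"
    "of_nat a / of_nat b \<le> (1 :: ennreal) \<longleftrightarrow> a \<le> b"
    "of_nat a / of_nat b < (1 :: ennreal) \<longleftrightarrow> a < b \<or> a = 0"
proof -
  have eq: "(of_nat a / of_nat b :: ennreal) = ennreal (real a / real b)" if "b > 0"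
    unfolding ennreal_of_nat_eq_real_of_nat by (rule divide_ennreal) (use that in simp_all)
  have top: "(of_nat a / of_nat 0 :: ennreal) = (if a = 0 then 0 else \<infinity>)"
    by (auto simp: divide_ennreal_def ennreal_mult_top)
  show "(1 :: ennreal) < of_nat a / of_nat b \<longleftrightarrow> b < a"
    using top by (cases "b = 0") (auto simp: eq ennreal_less_iff simp flip: ennreal_1)
  show "(1 :: ennreal) \<le> of_nat a / of_nat b \<longleftrightarrow> b \<le> a \<and> 0 < a"
    using top by (cases "b = 0") (auto simp: eq top_unique simp flip: ennreal_1)
  show "of_nat a / of_nat b \<le> (1 :: ennreal) \<longleftrightarrow> a \<le> b"
    using top by (cases "b = 0") (auto simp: eq top_unique simp flip: ennreal_1)
  show "of_nat a / of_nat b < (1 :: ennreal) \<longleftrightarrow> a < b \<or> a = 0"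
    using top by (cases "b = 0") (auto simp: eq ennreal_less_iff simp flip: ennreal_1)
qed

lemma sum_image_Phi_L:
  fixes A B C D :: "'k :: field mat"
  assumes A: "A \<in> carrier_mat n n" and C: "C \<in> carrier_mat p n" and U: "is_subspace n U"
  shows "sum_image (1\<^sub>m n @\<^sub>r 0\<^sub>m p n) (A @\<^sub>r C) U = {(u + A *\<^sub>v u') @\<^sub>v (C *\<^sub>v u') | u u'. u \<in> U \<and> u' \<in> U}"
proof -
  have "(1\<^sub>m n @\<^sub>r 0\<^sub>m p n) *\<^sub>v u + (A @\<^sub>r C) *\<^sub>v u' = (u + A *\<^sub>v u') @\<^sub>v (C *\<^sub>v u')"
    if "u \<in> U" "u' \<in> U" for u u'
  proof -
    note c = is_subspaceD(1)[OF U that(1)] is_subspaceD(1)[OF U that(2)]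
    have z: "0\<^sub>m p n *\<^sub>v u = (0\<^sub>v p :: 'k vec)" using c by (intro eq_vecI) auto
    have "(1\<^sub>m n @\<^sub>r 0\<^sub>m p n) *\<^sub>v u = u @\<^sub>v 0\<^sub>v p"
      using mat_mult_append[of "1\<^sub>m n" n n "0\<^sub>m p n" p u] c by (simp add: z)
    moreover have "(A @\<^sub>r C) *\<^sub>v u' = (A *\<^sub>v u') @\<^sub>v (C *\<^sub>v u')"
      by (rule mat_mult_append[OF A C c(2)])
    ultimately show ?thesis
      using c carrier_matD[OF A] carrier_matD[OF C] by (intro eq_vecI) auto
  qed
  then show ?thesis unfolding sum_image_def by (metis (no_types, lifting))
qed

text \<open>
  The identity block of \<open>M\<close> absorbs the summand \<open>D w\<close>, so the lower component is arbitrary.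
\<close>

lemma mat_im_Phi_L:
  fixes B D :: "'k :: field mat"
  assumes B: "B \<in> carrier_mat n m" and D: "D \<in> carrier_mat p m"
  shows "mat_im (four_block_mat (0\<^sub>m n p) B (1\<^sub>m p) D)
    = {(B *\<^sub>v w) @\<^sub>v z | w z. w \<in> carrier_vec m \<and> z \<in> carrier_vec p}" (is "mat_im ?M = ?R")
proof -
  have mult: "?M *\<^sub>v (a @\<^sub>v w) = (B *\<^sub>v w) @\<^sub>v (a + D *\<^sub>v w)"
    if a: "a \<in> carrier_vec p" and w: "w \<in> carrier_vec m" for a w
  proof -
    have z: "0\<^sub>m n p *\<^sub>v a = (0\<^sub>v n :: 'k vec)" using a by (intro eq_vecI) auto
    have "B *\<^sub>v w \<in> carrier_vec n" using mult_mat_vec_carrier[OF B w] .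
    then show ?thesis
      using four_block_mat_mult_vec[OF zero_carrier_mat B one_carrier_mat D a w] a z by simp
  qed
  have M: "dim_col ?M = p + m" using B D by simp
  show ?thesis
  proof (intro equalityI subsetI)
    fix x assume "x \<in> mat_im ?M"
    then obtain v where v: "v \<in> carrier_vec (p + m)" "x = ?M *\<^sub>v v"
      unfolding mat_im_def M by auto
    have "x = (B *\<^sub>v vec_last v m) @\<^sub>v (vec_first v p + D *\<^sub>v vec_last v m)"
      using mult[of "vec_first v p" "vec_last v m"] v by simp
    moreover have "vec_first v p + D *\<^sub>v vec_last v m \<in> carrier_vec p"
      using mult_mat_vec_carrier[OF D, of "vec_last v m"] by simp
    ultimately show "x \<in> ?R" using vec_last_carrier by blast
  next
    fix x assume "x \<in> ?R"
    then obtain w z where wz: "w \<in> carrier_vec m" "z \<in> carrier_vec p" "x = (B *\<^sub>v w) @\<^sub>v z" by auto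
    have Dw: "D *\<^sub>v w \<in> carrier_vec p" using mult_mat_vec_carrier[OF D wz(1)] .
    have zD: "z - D *\<^sub>v w \<in> carrier_vec p" using wz(2) Dw by simp
    have "z - D *\<^sub>v w + D *\<^sub>v w = z"
      using carrier_vecD[OF wz(2)] carrier_vecD[OF Dw] by (intro eq_vecI) auto
    then have "x = ?M *\<^sub>v ((z - D *\<^sub>v w) @\<^sub>v w)" using mult[OF zD wz(1)] wz(3) by simp
    moreover have "(z - D *\<^sub>v w) @\<^sub>v w \<in> carrier_vec (p + m)" using zD wz(1) by simp
    ultimately show "x \<in> mat_im ?M" unfolding mat_im_def M by (rule image_eqI)
  qed
qed

lemma pad_zero_subset:
  fixes U :: "'k :: field vec set"
  assumes A: "A \<in> carrier_mat n n" and C: "C \<in> carrier_mat p n" and U: "is_subspace n U"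
    and sub: "{(u + A *\<^sub>v u') @\<^sub>v (C *\<^sub>v u') | u u'. u \<in> U \<and> u' \<in> U} \<subseteq> V"
  shows "(\<lambda>u. u @\<^sub>v 0\<^sub>v p) ` U \<subseteq> V"
proof
  fix v assume "v \<in> (\<lambda>u. u @\<^sub>v 0\<^sub>v p) ` U"
  then obtain u where u: "u \<in> U" "v = u @\<^sub>v 0\<^sub>v p" by auto
  have "A *\<^sub>v 0\<^sub>v n = 0\<^sub>v n" using A by (intro eq_vecI) (auto simp: scalar_prod_def)
  moreover have "C *\<^sub>v 0\<^sub>v n = 0\<^sub>v p" using C by (intro eq_vecI) (auto simp: scalar_prod_def)
  \<comment> \<open>The pair with \<open>u' = 0\<close>.\<close>
  ultimately have "v = (u + A *\<^sub>v 0\<^sub>v n) @\<^sub>v (C *\<^sub>v 0\<^sub>v n)"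
    using u is_subspaceD(1)[OF U u(1)] by simp
  then show "v \<in> V" using sub u(1) is_subspaceD(2)[OF U] by blast
qed

lemma cylinder_subset:
  fixes U :: "'k :: field vec set"
  assumes B: "B \<in> carrier_mat n m" and V: "is_subspace (n + p) V"
    and pad: "(\<lambda>u. u @\<^sub>v 0\<^sub>v p) ` U \<subseteq> V"
    and im: "{(B *\<^sub>v w) @\<^sub>v z | w z. w \<in> carrier_vec m \<and> z \<in> carrier_vec p} \<subseteq> V"
  shows "cylinder n p U \<subseteq> V"
proof
  fix v assume v: "v \<in> cylinder n p U"
  then have vc: "v \<in> carrier_vec (n + p)" and "vec_first v n \<in> U" by (auto simp: cylinder_def)
  then have 1: "vec_first v n @\<^sub>v 0\<^sub>v p \<in> V" using pad by auto
  have "B *\<^sub>v 0\<^sub>v m = 0\<^sub>v n" using B by (intro eq_vecI) (auto simp: scalar_prod_def)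
  moreover have "(B *\<^sub>v 0\<^sub>v m) @\<^sub>v vec_last v p \<in> V"
    using im zero_carrier_vec vec_last_carrier by blast
  ultimately have 2: "0\<^sub>v n @\<^sub>v vec_last v p \<in> V" by simp
  have "v = (vec_first v n @\<^sub>v 0\<^sub>v p) + (0\<^sub>v n @\<^sub>v vec_last v p)"
    using vc by (intro eq_vecI) (auto simp: vec_first_def vec_last_def)
  then show "v \<in> V" using is_subspaceD(3)[OF V 1 2] by simp
qed

lemma append_vec_inj:
  assumes "u @\<^sub>v w = u' @\<^sub>v w'" "u \<in> carrier_vec n" "u' \<in> carrier_vec n"
  shows "u = u'" "w = w'"
  using append_vec_eq[OF assms(2,3), of w w'] assms(1) by auto

text \<open>
  Only the strict inequality has content.  It fails exactly for \<open>V = U \<times> 0\<close> with \<open>U\<close> nonzero, and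
  \<open>K (U) + L (U) \<subseteq> U \<times> 0\<close> says that \<open>U\<close> is invariant and killed by \<open>C\<close>.
\<close>

lemma lowerstable_Phi_L_iff_observable:
  fixes \<Sigma> :: "'k :: field lds"
  assumes \<Sigma>: "\<Sigma> \<in> lds_space n m p"
  shows "lowerstable n m p 1 (Phi_L n m p \<Sigma>) \<longleftrightarrow> observable n p (fst \<Sigma>) (fst (snd (snd \<Sigma>)))"
proof -
  obtain A B C D where S: "\<Sigma> = (A, B, C, D)" by (cases \<Sigma>)
  have A: "A \<in> carrier_mat n n" and B: "B \<in> carrier_mat n m" and C: "C \<in> carrier_mat p n"
    and D: "D \<in> carrier_mat p m" using lds_space_carrier[OF \<Sigma>] unfolding S by simp_all
  let ?K = "1\<^sub>m n @\<^sub>r 0\<^sub>m p n :: 'k mat" and ?L = "A @\<^sub>r C"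
    and ?M = "four_block_mat (0\<^sub>m n p) B (1\<^sub>m p) D"
  note im = sum_image_Phi_L[OF A C]
  have low: "lowerstable n m p 1 (Phi_L n m p \<Sigma>) \<longleftrightarrow>
    (\<forall>U V. is_subspace n U \<longrightarrow> is_subspace (n + p) V \<longrightarrow>
       ((sdim n U > 0 \<or> sdim (n + p) V > 0) \<and> sum_image ?K ?L U \<subseteq> V \<longrightarrow>
          sdim n U < sdim (n + p) V) \<and>
       ((U \<subset> carrier_vec n \<or> V \<subset> carrier_vec (n + p)) \<and> sum_image ?K ?L U \<subseteq> V \<and> mat_im ?M \<subseteq> V \<longrightarrow>
          n + p - sdim (n + p) V \<le> n - sdim n U))"
    unfolding lowerstable_def Phi_L_def S prod.case ennreal_slope ..
  show ?thesis
  proof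
    assume st: "lowerstable n m p 1 (Phi_L n m p \<Sigma>)"
    have "observable n p A C"
      unfolding observable_def
    proof (intro allI impI)
      fix U :: "'k vec set" assume U: "is_subspace n U" and AU: "\<forall>u\<in>U. A *\<^sub>v u \<in> U"
        and CU: "\<forall>u\<in>U. C *\<^sub>v u = 0\<^sub>v p"
      let ?V = "(\<lambda>u. u @\<^sub>v 0\<^sub>v p) ` U"
      have "sum_image ?K ?L U \<subseteq> ?V"
        unfolding im[OF U] using AU CU is_subspaceD(3)[OF U] by auto
      then have "\<not> sdim n U > 0"
        using st[unfolded low, rule_format, OF U sdim_pad_zero(1)[OF U]] sdim_pad_zero(2)[OF U] by auto
      then show "U = {0\<^sub>v n}" using sdim_eq_0[OF U] by simp
    qed
    then show "observable n p (fst \<Sigma>) (fst (snd (snd \<Sigma>)))" by (simp add: S)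
  next
    assume "observable n p (fst \<Sigma>) (fst (snd (snd \<Sigma>)))"
    then have obs: "observable n p A C" by (simp add: S)
    show "lowerstable n m p 1 (Phi_L n m p \<Sigma>)"
      unfolding low
    proof (intro allI impI conjI)
      fix U V :: "'k vec set" assume U: "is_subspace n U" and V: "is_subspace (n + p) V"
      let ?U = "(\<lambda>u. u @\<^sub>v 0\<^sub>v p) ` U"
      {
        assume "(sdim n U > 0 \<or> sdim (n + p) V > 0) \<and> sum_image ?K ?L U \<subseteq> V"
        then have pos: "sdim n U > 0 \<or> sdim (n + p) V > 0"
          and sub: "{(u + A *\<^sub>v u') @\<^sub>v (C *\<^sub>v u') | u u'. u \<in> U \<and> u' \<in> U} \<subseteq> V"
          unfolding im[OF U] by auto
        have pad: "?U \<subseteq> V" by (rule pad_zero_subset[OF A C U sub])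
        have le: "sdim n U \<le> sdim (n + p) V"
          using sdim_mono_eq(1)[OF sdim_pad_zero(1)[OF U] V pad] sdim_pad_zero(2)[OF U] by simp
        show "sdim n U < sdim (n + p) V"
        proof (rule ccontr)
          assume "\<not> ?thesis"
          then have eq: "sdim n U = sdim (n + p) V" and Upos: "sdim n U > 0" using le pos by auto
          then have VU: "?U = V"
            using sdim_mono_eq(2)[OF sdim_pad_zero(1)[OF U] V pad] sdim_pad_zero(2)[OF U] by simp
          have AC: "A *\<^sub>v u \<in> U \<and> C *\<^sub>v u = 0\<^sub>v p" if u: "u \<in> U" for u
          proof -
            have Au: "A *\<^sub>v u \<in> carrier_vec n"
              by (rule mult_mat_vec_carrier[OF A is_subspaceD(1)[OF U u]])
            have "(0\<^sub>v n + A *\<^sub>v u) @\<^sub>v (C *\<^sub>v u) \<in> ?U"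
              using sub u is_subspaceD(2)[OF U] unfolding VU by blast
            then obtain u' where u': "u' \<in> U" "(A *\<^sub>v u) @\<^sub>v (C *\<^sub>v u) = u' @\<^sub>v 0\<^sub>v p"
              using Au by auto
            from append_vec_inj[OF u'(2) Au is_subspaceD(1)[OF U u'(1)]] u'(1)
            show ?thesis by simp
          qed
          then have "U = {0\<^sub>v n}" using obs U unfolding observable_def by blast
          then show False using Upos by (simp add: sdim_zero)
        qed
      }
      {
        assume "(U \<subset> carrier_vec n \<or> V \<subset> carrier_vec (n + p)) \<and> sum_image ?K ?L U \<subseteq> V \<and> mat_im ?M \<subseteq> V"
        then have sub: "{(u + A *\<^sub>v u') @\<^sub>v (C *\<^sub>v u') | u u'. u \<in> U \<and> u' \<in> U} \<subseteq> V"
          and imV: "{(B *\<^sub>v w) @\<^sub>v z | w z. w \<in> carrier_vec m \<and> z \<in> carrier_vec p} \<subseteq> V"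
          unfolding im[OF U] mat_im_Phi_L[OF B D] by auto
        have "cylinder n p U \<subseteq> V"
          by (rule cylinder_subset[OF B V pad_zero_subset[OF A C U sub] imV])
        from sdim_mono_eq(1)[OF is_subspace_cylinder[OF U] V this]
        show "n + p - sdim (n + p) V \<le> n - sdim n U" using sdim_cylinder[OF U] by simp
      }
    qed
  qed
qed

text \<open>
  Again only the strict inequality has content.  It fails exactly for \<open>V = U \<times> k^p\<close> with \<open>U\<close> proper,
  and the inclusions in this \<open>V\<close> say that \<open>U\<close> is invariant and contains the image of \<open>B\<close>.
\<close>

lemma upperstable_Phi_L_iff_controllable:
  fixes \<Sigma> :: "'k :: field lds"
  assumes \<Sigma>: "\<Sigma> \<in> lds_space n m p"
  shows "upperstable n m p 1 (Phi_L n m p \<Sigma>) \<longleftrightarrow> controllable n m (fst \<Sigma>) (fst (snd \<Sigma>))"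
proof -
  obtain A B C D where S: "\<Sigma> = (A, B, C, D)" by (cases \<Sigma>)
  have A: "A \<in> carrier_mat n n" and B: "B \<in> carrier_mat n m" and C: "C \<in> carrier_mat p n"
    and D: "D \<in> carrier_mat p m" using lds_space_carrier[OF \<Sigma>] unfolding S by simp_all
  let ?K = "1\<^sub>m n @\<^sub>r 0\<^sub>m p n :: 'k mat" and ?L = "A @\<^sub>r C"
    and ?M = "four_block_mat (0\<^sub>m n p) B (1\<^sub>m p) D"
  note im = sum_image_Phi_L[OF A C] and imM = mat_im_Phi_L[OF B D]
  have up: "upperstable n m p 1 (Phi_L n m p \<Sigma>) \<longleftrightarrow>
    (\<forall>U V. is_subspace n U \<longrightarrow> is_subspace (n + p) V \<longrightarrow>
       ((sdim n U > 0 \<or> sdim (n + p) V > 0) \<and> sum_image ?K ?L U \<subseteq> V \<longrightarrow>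
          sdim n U \<le> sdim (n + p) V \<and> 0 < sdim (n + p) V) \<and>
       ((U \<subset> carrier_vec n \<or> V \<subset> carrier_vec (n + p)) \<and> sum_image ?K ?L U \<subseteq> V \<and> mat_im ?M \<subseteq> V \<longrightarrow>
          n + p - sdim (n + p) V < n - sdim n U \<or> n + p - sdim (n + p) V = 0))"
    unfolding upperstable_def Phi_L_def S prod.case ennreal_slope ..
  show ?thesis
  proof
    assume st: "upperstable n m p 1 (Phi_L n m p \<Sigma>)"
    have "controllable n m A B"
      unfolding controllable_def
    proof (intro allI impI)
      fix U :: "'k vec set" assume U: "is_subspace n U" and AU: "\<forall>u\<in>U. A *\<^sub>v u \<in> U"
        and BU: "\<forall>w\<in>carrier_vec m. B *\<^sub>v w \<in> U"
      let ?V = "cylinder n p U"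
      note c = is_subspaceD(1)[OF U]
      have in_cyl: "u @\<^sub>v w \<in> ?V" if "u \<in> U" "w \<in> carrier_vec p" for u w
        using that c[OF that(1)] by (simp add: cylinder_def vec_first_append)
      have 1: "sum_image ?K ?L U \<subseteq> ?V"
        unfolding im[OF U] using AU in_cyl is_subspaceD(3)[OF U] mult_mat_vec_carrier[OF C c] by auto
      have 2: "mat_im ?M \<subseteq> ?V"
        unfolding imM using BU in_cyl by auto
      have "\<not> U \<subset> carrier_vec n"
      proof
        assume proper: "U \<subset> carrier_vec n"
        have sub: "U \<subseteq> carrier_vec n" using c by auto
        have "sdim n U \<le> n"
          using sdim_mono_eq(1)[OF U is_subspace_carrier sub] by (simp add: sdim_carrier)
        moreover have "sdim n U \<noteq> n"
          using sdim_mono_eq(2)[OF U is_subspace_carrier sub] proper by (auto simp: sdim_carrier)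
        ultimately show False
          using st[unfolded up, rule_format, OF U is_subspace_cylinder[OF U]] proper 1 2
          by (auto simp: sdim_cylinder[OF U])
      qed
      then show "U = carrier_vec n" using c by blast
    qed
    then show "controllable n m (fst \<Sigma>) (fst (snd \<Sigma>))" by (simp add: S)
  next
    assume "controllable n m (fst \<Sigma>) (fst (snd \<Sigma>))"
    then have ctr: "controllable n m A B" by (simp add: S)
    show "upperstable n m p 1 (Phi_L n m p \<Sigma>)"
      unfolding up
    proof (intro allI impI)
      fix U V :: "'k vec set" assume U: "is_subspace n U" and V: "is_subspace (n + p) V"
      let ?U = "(\<lambda>u. u @\<^sub>v 0\<^sub>v p) ` U"
      have pad: "?U \<subseteq> V" if "sum_image ?K ?L U \<subseteq> V"
        by (rule pad_zero_subset[OF A C U that[unfolded im[OF U]]])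
      have "sdim n U \<le> sdim (n + p) V" if "sum_image ?K ?L U \<subseteq> V"
        using sdim_mono_eq(1)[OF sdim_pad_zero(1)[OF U] V pad[OF that]] sdim_pad_zero(2)[OF U] by simp
      then have one: "(sdim n U > 0 \<or> sdim (n + p) V > 0) \<and> sum_image ?K ?L U \<subseteq> V \<longrightarrow>
          sdim n U \<le> sdim (n + p) V \<and> 0 < sdim (n + p) V" by auto
      have two: "n + p - sdim (n + p) V < n - sdim n U \<or> n + p - sdim (n + p) V = 0"
        if "U \<subset> carrier_vec n \<or> V \<subset> carrier_vec (n + p)" "sum_image ?K ?L U \<subseteq> V" "mat_im ?M \<subseteq> V"
      proof -
        have cyl: "cylinder n p U \<subseteq> V"
          by (rule cylinder_subset[OF B V pad[OF that(2)] that(3)[unfolded imM]])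
        note cyl_sub = is_subspace_cylinder[OF U, of p]
        have VC: "V \<subseteq> carrier_vec (n + p)" using is_subspaceD(1)[OF V] by auto
        have "sdim (n + p) V \<le> n + p"
          using sdim_mono_eq(1)[OF V is_subspace_carrier VC] by (simp add: sdim_carrier)
        moreover have "sdim n U + p \<le> sdim (n + p) V"
          using sdim_mono_eq(1)[OF cyl_sub V cyl] by (simp add: sdim_cylinder[OF U])
        moreover have "sdim n U + p \<noteq> sdim (n + p) V"
        proof
          assume "sdim n U + p = sdim (n + p) V"
          then have eq: "cylinder n p U = V"
            using sdim_mono_eq(2)[OF cyl_sub V cyl] by (simp add: sdim_cylinder[OF U])
          have first: "vec_first v n \<in> U" if "v \<in> V" for v
            using that unfolding eq[symmetric] by (simp add: cylinder_def)
          have "A *\<^sub>v u \<in> U" if u: "u \<in> U" for u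
          proof -
            have Au: "A *\<^sub>v u \<in> carrier_vec n"
              by (rule mult_mat_vec_carrier[OF A is_subspaceD(1)[OF U u]])
            have "(0\<^sub>v n + A *\<^sub>v u) @\<^sub>v (C *\<^sub>v u) \<in> V"
              using \<open>sum_image ?K ?L U \<subseteq> V\<close> u is_subspaceD(2)[OF U] unfolding im[OF U] by blast
            then show ?thesis using first vec_first_append[OF Au] Au by fastforce
          qed
          moreover have "B *\<^sub>v w \<in> U" if w: "w \<in> carrier_vec m" for w
          proof -
            have "(B *\<^sub>v w) @\<^sub>v 0\<^sub>v p \<in> V"
              using \<open>mat_im ?M \<subseteq> V\<close> w zero_carrier_vec unfolding imM by blast
            then show ?thesis using first vec_first_append[OF mult_mat_vec_carrier[OF B w]] by fastforce
          qed
          ultimately have UC: "U = carrier_vec n" using ctr U unfolding controllable_def by blast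
          then have "V = carrier_vec (n + p)"
            unfolding eq[symmetric] cylinder_def by auto
          then show False using UC that(1) by blast
        qed
        ultimately show ?thesis by linarith
      qed
      show "((sdim n U > 0 \<or> sdim (n + p) V > 0) \<and> sum_image ?K ?L U \<subseteq> V \<longrightarrow>
          sdim n U \<le> sdim (n + p) V \<and> 0 < sdim (n + p) V) \<and>
       ((U \<subset> carrier_vec n \<or> V \<subset> carrier_vec (n + p)) \<and> sum_image ?K ?L U \<subseteq> V \<and> mat_im ?M \<subseteq> V \<longrightarrow>
          n + p - sdim (n + p) V < n - sdim n U \<or> n + p - sdim (n + p) V = 0)"
        using one by (rule conjI) (intro impI, elim conjE, rule two)
    qed
  qed
qed

theorem proposition2p10:
  fixes n m p :: nat
    and \<Sigma> :: "'k :: {alg_closed_field, field_char_0} lds"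
  assumes "n > 0"
    and "\<Sigma> \<in> lds_space n m p"
  shows "(chi_stable n m p (- 1) \<Sigma> \<longleftrightarrow> lowerstable n m p 1 (Phi_L n m p \<Sigma>)) \<and>
         (chi_stable n m p 1 \<Sigma> \<longleftrightarrow> upperstable n m p 1 (Phi_L n m p \<Sigma>))"
  unfolding chi_stable_minus_1_iff_observable[OF assms(2)] chi_stable_1_iff_controllable[OF assms(2)]
    lowerstable_Phi_L_iff_observable[OF assms(2)] upperstable_Phi_L_iff_controllable[OF assms(2)]
  by simp

end
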